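(* Let $M\ge 1$, let $\Lambda=\{1,\dots,M\}$, let $A$ be a complex $\Lambda\times\Lambda$ matrix with positive Hermitian part, and let $C=A^{-1}$ denote its inverse. For all $a,b\in\Lambda$ (not necessarily distinct), the self-avoiding walk two-point function $G^{\rm saw}_{a,b}=\sum_{\omega\in\mathcal S_{a,b}}C^\omega$ satisfies $$G^{\rm saw}_{a,b}=\int e^{-S_A}\,\bar\phi_a\phi_b\prod_{x\in\Lambda\setminus\{a,b\}}(1+\tau_x).$$
   Context: Positive Hermitian part: a complex $\Lambda\times\Lambda$ matrix $A$ has positive Hermitian part if $\sum_{x,y}\phi_x(A_{x,y}+\overline{A_{y,x}})\bar\phi_y>0$ for all nonzero $\phi\in\mathbb C^M$. Self-avoiding walks: for not necessarily distinct $a,b\in\Lambda$, a self-avoiding walk from $a$ to $b$ is a sequence $\omega=(x_0=a,x_1,\dots,x_n=b)$ with $n\ge1$, where $x_1,\dots,x_{n-1}$ are distinct points of $\Lambda\setminus\{a,b\}$. The set of all of these is $\mathcal S_{a,b}$, and $C^\omega=\prod_{i=1}^n C_{x_{i-1},x_i}$. (When $a=b$ the one-step walk from $a$ to $a$ is included, with weight $C_{a,a}$.) Differential forms: let $u_1,v_1,\dots,u_M,v_M$ be standard coordinates on $\mathbb R^{2M}$; differentials are multiplied with the anticommuting wedge product (the wedge is omitted from the notation). For $x\in\Lambda$ put $\phi_x=u_x+iv_x$, $\bar\phi_x=u_x-iv_x$, $d\phi_x=du_x+i\,dv_x$, $d\bar\phi_x=du_x-i\,dv_x$, $\psi_x=(2\pi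 i)^{-1/2}d\phi_x$, $\bar\psi_x=(2\pi i)^{-1/2}d\bar\phi_x$ (one fixed choice of the square root). Thus $\bar\psi_x\psi_x=\frac1\pi du_x\,dv_x$. Write $\phi A\bar\phi=\sum_{x,y}\phi_xA_{x,y}\bar\phi_y$ and $\psi A\bar\psi=\sum_{x,y}A_{x,y}\psi_x\bar\psi_y$, and set $$S_A=\phi A\bar\phi+\psi A\bar\psi,\qquad \tau_x=\phi_x\bar\phi_x+\psi_x\bar\psi_x .$$ The form $e^{-S_A}$ is defined by $e^{-S_A}=e^{-\phi A\bar\phi}\sum_{n=0}^{M}\frac{(-1)^n}{n!}(\psi A\bar\psi)^n$. Integration: the integral of a form is computed from its degree-$2M$ part only (all parts of other degree integrate to $0$), and $\int f(u,v)\,du_1dv_1\cdots du_Mdv_M$ is the Lebesgue integral of $f$ over $\mathbb R^{2M}$. *)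

theory Defs
  imports "HOL-Analysis.Analysis"
begin

text \<open>
  The index set \<open>\<Lambda> = {1, \<dots>, M}\<close> is a finite linearly ordered type \<open>'n\<close> with \<open>M = CARD('n)\<close>. The order
  only serves to fix the sign conventions for differential forms.
\<close>

section \<open>Positive Hermitian part\<close>

text \<open>The sum below is always real, so that its positivity is positivity of its real part.\<close>

definition positive_hermitian_part :: "complex^'n^'n \<Rightarrow> bool" where
  "positive_hermitian_part A \<longleftrightarrow>
     (\<forall>\<phi> :: complex^'n. \<phi> \<noteq> 0 \<longrightarrow>
        0 < Re (\<Sum>x\<in>UNIV. \<Sum>y\<in>UNIV. \<phi> $ x * (A $ x $ y + cnj (A $ y $ x)) * cnj (\<phi> $ y)))"

lemma positive_hermitian_part_invertible:
  fixes A :: "complex^'n^'n"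
  assumes "positive_hermitian_part A"
  shows "invertible A"
proof -
  have "v = 0" if v: "A *v v = 0" for v
  proof (rule ccontr)
    assume "v \<noteq> 0"
    define w where "w = (\<chi> x. cnj (v $ x))"
    have "w \<noteq> 0"
      using \<open>v \<noteq> 0\<close> by (auto simp: w_def vec_eq_iff)
    have row: "(\<Sum>y\<in>UNIV. A $ x $ y * v $ y) = 0" for x
      using v by (simp add: matrix_vector_mult_def vec_eq_iff)
    have 1: "(\<Sum>x\<in>UNIV. \<Sum>y\<in>UNIV. w $ x * A $ x $ y * cnj (w $ y)) = 0"
    proof (rule sum.neutral, rule ballI)
      fix x
      have "(\<Sum>y\<in>UNIV. w $ x * A $ x $ y * cnj (w $ y)) = w $ x * (\<Sum>y\<in>UNIV. A $ x $ y * v $ y)"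
        by (simp add: w_def sum_distrib_left mult.assoc)
      then show "(\<Sum>y\<in>UNIV. w $ x * A $ x $ y * cnj (w $ y)) = 0"
        by (simp only: row mult_zero_right)
    qed
    have "(\<Sum>x\<in>UNIV. \<Sum>y\<in>UNIV. w $ x * cnj (A $ y $ x) * cnj (w $ y)) =
          (\<Sum>y\<in>UNIV. \<Sum>x\<in>UNIV. w $ x * cnj (A $ y $ x) * cnj (w $ y))"
      by (rule sum.swap)
    also have "\<dots> = (\<Sum>y\<in>UNIV. v $ y * cnj (\<Sum>x\<in>UNIV. A $ y $ x * v $ x))"
      by (simp add: w_def sum_distrib_left mult_ac)
    also have "\<dots> = 0"
      by (simp only: row complex_cnj_zero mult_zero_right sum.neutral_const)
    finally have 2: "(\<Sum>x\<in>UNIV. \<Sum>y\<in>UNIV. w $ x * cnj (A $ y $ x) * cnj (w $ y)) = 0" .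
    have "(\<Sum>x\<in>UNIV. \<Sum>y\<in>UNIV. w $ x * (A $ x $ y + cnj (A $ y $ x)) * cnj (w $ y)) = 0"
      by (simp only: distrib_left distrib_right sum.distrib 1 2 add_0)
    moreover have "0 < Re (\<Sum>x\<in>UNIV. \<Sum>y\<in>UNIV. w $ x * (A $ x $ y + cnj (A $ y $ x)) * cnj (w $ y))"
      using assms \<open>w \<noteq> 0\<close> unfolding positive_hermitian_part_def by blast
    ultimately show False
      by (simp only: zero_complex.sel less_irrefl)
  qed
  then have "\<exists>B. B ** A = mat 1"
    by (simp only: matrix_left_invertible_ker) blast
  then show ?thesis
    by (simp only: invertible_left_inverse)
qed

section \<open>Self-avoiding walks\<close>

text \<open>
  The list \<open>a # xs @ [b]\<close> is the walk \<open>(x\<^sub>0, \<dots>, x\<^sub>n)\<close> with \<open>n = length xs + 1\<close>; the endpoints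
  may coincide.
\<close>

definition self_avoiding_walks :: "'n \<Rightarrow> 'n \<Rightarrow> 'n list set" where
  "self_avoiding_walks a b = {a # xs @ [b] | xs. distinct xs \<and> set xs \<inter> {a, b} = {}}"

definition walk_weight :: "complex^'n^'n \<Rightarrow> 'n list \<Rightarrow> complex" where
  "walk_weight C w = (\<Prod>i = 1..length w - 1. C $ (w ! (i - 1)) $ (w ! i))"

definition saw_two_point :: "complex^'n^'n \<Rightarrow> 'n \<Rightarrow> 'n \<Rightarrow> complex" where
  "saw_two_point C a b = (\<Sum>w\<in>self_avoiding_walks a b. walk_weight C w)"

lemma finite_self_avoiding_walks: "finite (self_avoiding_walks a (b :: 'n::finite))"
proof -
  have "self_avoiding_walks a b \<subseteq> (\<lambda>xs. a # xs @ [b]) ` {xs. set xs \<subseteq> UNIV \<and> distinct xs}"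
    by (auto simp: self_avoiding_walks_def)
  then show ?thesis
    using finite_subset finite_imageI finite_subset_distinct[OF finite] by blast
qed

section \<open>Complex differential forms on \<open>\<real>\<^sup>2\<^sup>M\<close>\<close>

text \<open>A point of \<open>\<real>\<^sup>2\<^sup>M\<close> is a pair \<open>(u, v)\<close>; the coordinates are ordered \<open>u\<^sub>1, v\<^sub>1, u\<^sub>2, v\<^sub>2, \<dots>\<close>.\<close>

datatype 'n coord = Cu 'n | Cv 'n

instance coord :: (finite) finite
proof
  have "(UNIV :: 'a coord set) = range Cu \<union> range Cv"
    by (metis UNIV_eq_I UnI1 UnI2 coord.exhaust rangeI)
  then show "finite (UNIV :: 'a coord set)"
    by (metis finite finite_UnI finite_imageI)
qed

fun precedes :: "'n::linorder coord \<Rightarrow> 'n coord \<Rightarrow> bool" where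
  "precedes (Cu x) (Cu y) \<longleftrightarrow> x < y"
| "precedes (Cu x) (Cv y) \<longleftrightarrow> x \<le> y"
| "precedes (Cv x) (Cu y) \<longleftrightarrow> x < y"
| "precedes (Cv x) (Cv y) \<longleftrightarrow> x < y"

text \<open>
  A form is given by its coefficients, \<open>\<omega> = (\<Sum>S. form_coeff \<omega> p S \<cdot> e\<^sub>S)\<close> at the point \<open>p\<close>, where \<open>e\<^sub>S\<close> is the
  wedge product of the coordinate differentials in \<open>S\<close>, taken in increasing order. Hence
  \<open>e\<^sub>S e\<^sub>T = wedge_sign S T \<cdot> e\<^bsub>S \<union> T\<^esub>\<close> if \<open>S\<close> and \<open>T\<close> are disjoint, and \<open>e\<^sub>S e\<^sub>T = 0\<close> otherwise.
\<close>

typedef 'n form = "UNIV :: ((real^'n) \<times> (real^'n) \<Rightarrow> 'n coord set \<Rightarrow> complex) set"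
  morphisms form_coeff Form ..

lemma form_coeff_Form [simp]: "form_coeff (Form f) = f"
  by (simp add: Form_inverse)

lemma form_eqI: "(\<And>p S. form_coeff \<omega> p S = form_coeff \<eta> p S) \<Longrightarrow> \<omega> = \<eta>"
  by (metis form_coeff_inject ext)

definition wedge_sign :: "'n::linorder coord set \<Rightarrow> 'n coord set \<Rightarrow> complex" where
  "wedge_sign S T = (-1) ^ card {(s, t). s \<in> S \<and> t \<in> T \<and> precedes t s}"

lemma wedge_sign_empty [simp]: "wedge_sign {} T = 1" "wedge_sign S {} = 1"
  by (simp_all add: wedge_sign_def)

lemma wedge_sign_Un_left:
  fixes S T R :: "'n::{finite,linorder} coord set"
  assumes "S \<inter> T = {}"
  shows "wedge_sign (S \<union> T) R = wedge_sign S R * wedge_sign T R"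
proof -
  have "{(s, t). s \<in> S \<union> T \<and> t \<in> R \<and> precedes t s} =
        {(s, t). s \<in> S \<and> t \<in> R \<and> precedes t s} \<union> {(s, t). s \<in> T \<and> t \<in> R \<and> precedes t s}"
    by auto
  moreover have "{(s, t). s \<in> S \<and> t \<in> R \<and> precedes t s} \<inter>
        {(s, t). s \<in> T \<and> t \<in> R \<and> precedes t s} = {}"
    using assms by auto
  ultimately show ?thesis
    unfolding wedge_sign_def by (simp add: card_Un_disjoint power_add)
qed

lemma wedge_sign_Un_right:
  fixes S T R :: "'n::{finite,linorder} coord set"
  assumes "T \<inter> R = {}"
  shows "wedge_sign S (T \<union> R) = wedge_sign S T * wedge_sign S R"
proof -
  have "{(s, t). s \<in> S \<and> t \<in> T \<union> R \<and> precedes t s} =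
        {(s, t). s \<in> S \<and> t \<in> T \<and> precedes t s} \<union> {(s, t). s \<in> S \<and> t \<in> R \<and> precedes t s}"
    by auto
  moreover have "{(s, t). s \<in> S \<and> t \<in> T \<and> precedes t s} \<inter>
        {(s, t). s \<in> S \<and> t \<in> R \<and> precedes t s} = {}"
    using assms by auto
  ultimately show ?thesis
    unfolding wedge_sign_def by (simp add: card_Un_disjoint power_add)
qed

text \<open>The product of forms is the wedge product.\<close>

instantiation form :: ("{finite,linorder}") ring_1
begin

definition "0 = Form (\<lambda>p S. 0)"
definition "1 = Form (\<lambda>p S. if S = {} then 1 else 0)"
definition "\<omega> + \<eta> = Form (\<lambda>p S. form_coeff \<omega> p S + form_coeff \<eta> p S)"
definition "\<omega> - \<eta> = Form (\<lambda>p S. form_coeff \<omega> p S - form_coeff \<eta> p S)"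
definition "- \<omega> = Form (\<lambda>p S. - form_coeff \<omega> p S)"
definition "\<omega> * \<eta> = Form (\<lambda>p S. \<Sum>T\<in>Pow S. wedge_sign T (S - T) * form_coeff \<omega> p T * form_coeff \<eta> p (S - T))"

instance
proof
  fix \<omega> \<eta> \<theta> :: "'a form"
  show "\<omega> * \<eta> * \<theta> = \<omega> * (\<eta> * \<theta>)"
  proof (rule form_eqI)
    fix p S
    have "form_coeff (\<omega> * \<eta> * \<theta>) p S =
      (\<Sum>(R, T)\<in>Sigma (Pow S) Pow. wedge_sign R (S - R) * (wedge_sign T (R - T)
          * form_coeff \<omega> p T * form_coeff \<eta> p (R - T)) * form_coeff \<theta> p (S - R))"
      by (simp add: times_form_def sum_distrib_left sum_distrib_right sum.Sigma)
    also have "\<dots> = (\<Sum>(T, Q)\<in>Sigma (Pow S) (\<lambda>T. Pow (S - T)).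
        wedge_sign T (S - T) * form_coeff \<omega> p T * (wedge_sign Q (S - T - Q) * form_coeff \<eta> p Q
          * form_coeff \<theta> p (S - T - Q)))"
    proof (rule sum.reindex_bij_witness[where i = "\<lambda>(T, Q). (T \<union> Q, T)" and j = "\<lambda>(R, T). (T, R - T)"],
        goal_cases)
      case (5 a)
      then obtain R T where a: "a = (R, T)" "T \<subseteq> R" "R \<subseteq> S" by auto
      have "wedge_sign R (S - R) = wedge_sign T (S - R) * wedge_sign (R - T) (S - R)"
        using wedge_sign_Un_left[of T "R - T" "S - R"] a by (simp add: Un_absorb1)
      moreover have "wedge_sign T (S - T) = wedge_sign T (R - T) * wedge_sign T (S - R)"
      proof -
        have "S - T = (R - T) \<union> (S - R)" using a by auto
        then show ?thesis using wedge_sign_Un_right[of "R - T" "S - R" T] by auto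
      qed
      moreover have "S - T - (R - T) = S - R" using a by auto
      ultimately show ?case using a by (simp add: mult_ac)
    qed auto
    also have "\<dots> = form_coeff (\<omega> * (\<eta> * \<theta>)) p S"
      by (simp add: times_form_def sum_distrib_left sum.Sigma)
    finally show "form_coeff (\<omega> * \<eta> * \<theta>) p S = form_coeff (\<omega> * (\<eta> * \<theta>)) p S" .
  qed
  show "1 * \<omega> = \<omega>"
  proof (rule form_eqI)
    fix p S
    have "form_coeff (1 * \<omega>) p S = (\<Sum>T\<in>Pow S. if T = {} then form_coeff \<omega> p S else 0)"
      unfolding times_form_def one_form_def form_coeff_Form by (rule sum.cong) auto
    then show "form_coeff (1 * \<omega>) p S = form_coeff \<omega> p S" by simp
  qed
  show "\<omega> * 1 = \<omega>"
  proof (rule form_eqI)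
    fix p S
    have "form_coeff (\<omega> * 1) p S = (\<Sum>T\<in>Pow S. if T = S then form_coeff \<omega> p S else 0)"
      unfolding times_form_def one_form_def form_coeff_Form by (rule sum.cong) auto
    then show "form_coeff (\<omega> * 1) p S = form_coeff \<omega> p S" by simp
  qed
  show "(\<omega> + \<eta>) * \<theta> = \<omega> * \<theta> + \<eta> * \<theta>" "\<omega> * (\<eta> + \<theta>) = \<omega> * \<eta> + \<omega> * \<theta>"
    by (rule form_eqI, simp add: times_form_def plus_form_def algebra_simps sum.distrib)+
  have "form_coeff (0 :: 'a form) p {} \<noteq> form_coeff 1 p {}" for p
    by (simp add: zero_form_def one_form_def)
  then show "(0 :: 'a form) \<noteq> 1" by metis
qed (auto intro!: form_eqI simp: plus_form_def zero_form_def minus_form_def uminus_form_def)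

end

definition fun_form :: "((real^'n) \<times> (real^'n) \<Rightarrow> complex) \<Rightarrow> 'n form" where
  "fun_form f = Form (\<lambda>p S. if S = {} then f p else 0)"

abbreviation const_form :: "complex \<Rightarrow> 'n::finite form" where
  "const_form c \<equiv> fun_form (\<lambda>_. c)"

definition coord_diff :: "'n::finite coord \<Rightarrow> 'n form" where
  "coord_diff c = Form (\<lambda>p S. if S = {c} then 1 else 0)"

lemma const_form_mult: "const_form c * const_form d = (const_form (c * d) :: 'n::{finite,linorder} form)"
proof (rule form_eqI)
  fix p and S :: "'n coord set"
  have "form_coeff (const_form c * const_form d) p S = (\<Sum>T\<in>Pow S. if T = {} then (if S = {} then c * d else 0) else 0)"
    unfolding times_form_def fun_form_def form_coeff_Form by (rule sum.cong) auto
  then show "form_coeff (const_form c * const_form d) p S = form_coeff (const_form (c * d)) p S"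
    by (simp add: fun_form_def)
qed

lemma const_form_add: "const_form c + const_form d = (const_form (c + d) :: 'n::{finite,linorder} form)"
  by (rule form_eqI) (simp add: fun_form_def plus_form_def)

lemma const_form_commute: "\<omega> * const_form c = const_form c * (\<omega> :: 'n::{finite,linorder} form)"
proof (rule form_eqI)
  fix p and S :: "'n coord set"
  have "form_coeff (\<omega> * const_form c) p S = (\<Sum>T\<in>Pow S. if T = S then c * form_coeff \<omega> p S else 0)"
    unfolding times_form_def fun_form_def form_coeff_Form by (rule sum.cong) auto
  moreover have "form_coeff (const_form c * \<omega>) p S = (\<Sum>T\<in>Pow S. if T = {} then c * form_coeff \<omega> p S else 0)"
    unfolding times_form_def fun_form_def form_coeff_Form by (rule sum.cong) auto
  ultimately show "form_coeff (\<omega> * const_form c) p S = form_coeff (const_form c * \<omega>) p S"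
    by simp
qed

lemma form_coeff_coord_diff_mult:
  "form_coeff (coord_diff c * coord_diff d) p S =
    (if c \<noteq> d \<and> S = {c, d} then wedge_sign {c} {d} else 0)"
proof -
  have "form_coeff (coord_diff c * coord_diff d) p S =
      (\<Sum>T\<in>Pow S. if T = {c} then (if S - {c} = {d} then wedge_sign {c} {d} else 0) else 0)"
    unfolding times_form_def coord_diff_def form_coeff_Form by (rule sum.cong) auto
  also have "\<dots> = (if c \<in> S \<and> S - {c} = {d} then wedge_sign {c} {d} else 0)"
    by simp
  also have "(c \<in> S \<and> S - {c} = {d}) = (c \<noteq> d \<and> S = {c, d})"
    by blast
  finally show ?thesis .
qed

lemma wedge_sign_singletons: "wedge_sign {c} {d} = (if precedes d c then -1 else 1)"
proof -
  have "{(s, t). s \<in> {c} \<and> t \<in> {d} \<and> precedes t s} = (if precedes d c then {(c, d)} else {})"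
    by auto
  then show ?thesis
    by (simp add: wedge_sign_def)
qed

lemma coord_diff_square: "coord_diff c * coord_diff c = 0"
  by (rule form_eqI) (simp add: form_coeff_coord_diff_mult zero_form_def)

lemma precedes_total: "c \<noteq> d \<Longrightarrow> precedes c d \<longleftrightarrow> \<not> precedes d c"
  by (cases c; cases d) auto

lemma coord_diff_anticommute: "coord_diff c * coord_diff d = - (coord_diff d * coord_diff c)"
proof (rule form_eqI)
  fix p S
  have "wedge_sign {c} {d} = - wedge_sign {d} {c}" if "c \<noteq> d"
    using precedes_total[OF that] by (simp only: wedge_sign_singletons) simp
  then show "form_coeff (coord_diff c * coord_diff d) p S = form_coeff (- (coord_diff d * coord_diff c)) p S"
    unfolding uminus_form_def form_coeff_Form form_coeff_coord_diff_mult
    by (simp add: insert_commute)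
qed

text \<open>
  Only the coefficient of \<open>du\<^sub>1 dv\<^sub>1 \<dots> du\<^sub>M dv\<^sub>M\<close>, the increasing product of all the coordinate
  differentials, contributes to the integral.
\<close>

definition form_integrable :: "'n::finite form \<Rightarrow> bool" where
  "form_integrable \<omega> \<longleftrightarrow> integrable lborel (\<lambda>p. form_coeff \<omega> p UNIV)"

definition form_integral :: "'n::finite form \<Rightarrow> complex" where
  "form_integral \<omega> = (\<integral>p. form_coeff \<omega> p UNIV \<partial>lborel)"

section \<open>The bosonic and fermionic fields\<close>

definition phi :: "'n \<Rightarrow> (real^'n) \<times> (real^'n) \<Rightarrow> complex" where
  "phi x = (\<lambda>(u, v). of_real (u $ x) + \<i> * of_real (v $ x))"

definition phi_bar :: "'n \<Rightarrow> (real^'n) \<times> (real^'n) \<Rightarrow> complex" where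
  "phi_bar x = (\<lambda>(u, v). of_real (u $ x) - \<i> * of_real (v $ x))"

definition dphi :: "'n \<Rightarrow> 'n::{finite,linorder} form" where
  "dphi x = coord_diff (Cu x) + const_form \<i> * coord_diff (Cv x)"

definition dphi_bar :: "'n \<Rightarrow> 'n::{finite,linorder} form" where
  "dphi_bar x = coord_diff (Cu x) - const_form \<i> * coord_diff (Cv x)"

text \<open>The square root of \<open>2\<pi>i\<close> is fixed to be the principal one.\<close>

definition psi :: "'n \<Rightarrow> 'n::{finite,linorder} form" where
  "psi x = const_form (1 / csqrt (2 * of_real pi * \<i>)) * dphi x"

definition psi_bar :: "'n \<Rightarrow> 'n::{finite,linorder} form" where
  "psi_bar x = const_form (1 / csqrt (2 * of_real pi * \<i>)) * dphi_bar x"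

lemma psi_bar_mult_psi:
  "psi_bar x * psi x = const_form (1 / of_real pi) * (coord_diff (Cu x) * coord_diff (Cv x))"
proof -
  have const_form_absorb: "const_form c * (const_form d * \<omega>) = const_form (c * d) * \<omega>" for c d and \<omega> :: "'a form"
    by (simp add: const_form_mult flip: mult.assoc)
  have left_commute: "\<eta> * (const_form c * \<omega>) = const_form c * (\<eta> * \<omega>)" for c and \<eta> \<omega> :: "'a form"
    by (metis const_form_commute mult.assoc)
  note pull = left_commute[of "coord_diff e" for e]
    left_commute[of "coord_diff e - \<eta>" for e \<eta>]
  define k where "k = 1 / csqrt (2 * of_real pi * \<i>)"
  have "k * k = 1 / (csqrt (2 * of_real pi * \<i>))\<^sup>2"
    by (simp add: k_def power2_eq_square)
  then have k: "k * k * (2 * \<i>) = 1 / of_real pi"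
    by simp
  let ?u = "coord_diff (Cu x)" and ?v = "coord_diff (Cv x)"
  have "psi_bar x * psi x =
      const_form k * ((?u - const_form \<i> * ?v) * (const_form k * (?u + const_form \<i> * ?v)))"
    by (simp add: psi_def psi_bar_def dphi_def dphi_bar_def mult.assoc k_def)
  also have "\<dots> = const_form (k * k) * ((?u - const_form \<i> * ?v) * (?u + const_form \<i> * ?v))"
    by (simp only: mult.assoc pull const_form_absorb)
  also have "(?u - const_form \<i> * ?v) * (?u + const_form \<i> * ?v) =
      ?u * ?u + const_form \<i> * (?u * ?v) - const_form \<i> * (?v * ?u) - const_form (\<i> * \<i>) * (?v * ?v)"
  proof -
    have "?u * (const_form \<i> * ?v) = const_form \<i> * (?u * ?v)"
      "const_form \<i> * ?v * (const_form \<i> * ?v) = const_form (\<i> * \<i>) * (?v * ?v)"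
      by (simp_all only: mult.assoc pull const_form_absorb)
    then show ?thesis by (simp add: algebra_simps)
  qed
  also have "\<dots> = const_form \<i> * (?u * ?v) + const_form \<i> * (?u * ?v)"
    using coord_diff_anticommute[of "Cv x" "Cu x"] by (simp add: coord_diff_square)
  also have "\<dots> = const_form (2 * \<i>) * (?u * ?v)"
    by (simp add: const_form_add flip: distrib_right)
  finally show ?thesis
    by (simp only: const_form_absorb k)
qed

definition phi_quad :: "complex^'n^'n \<Rightarrow> (real^'n) \<times> (real^'n) \<Rightarrow> complex" where
  "phi_quad A p = (\<Sum>x\<in>UNIV. \<Sum>y\<in>UNIV. phi x p * A $ x $ y * phi_bar y p)"

definition psi_quad :: "complex^'n::{finite,linorder}^'n::{finite,linorder} \<Rightarrow> 'n::{finite,linorder} form" where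
  "psi_quad A = (\<Sum>x\<in>UNIV. \<Sum>y\<in>UNIV. const_form (A $ x $ y) * psi x * psi_bar y)"

text \<open>The form \<open>e\<^bsup>-S\<^esup>\<close> for \<open>S = \<phi>A\<phi>\<^sup>* + \<psi>A\<psi>\<^sup>*\<close>, where \<open>*\<close> stands for the bar.\<close>

definition exp_neg_S :: "complex^'n::{finite,linorder}^'n::{finite,linorder} \<Rightarrow> 'n::{finite,linorder} form" where
  "exp_neg_S A = fun_form (\<lambda>p. exp (- phi_quad A p)) *
     (\<Sum>n = 0..CARD('n). const_form ((-1) ^ n / fact n) * psi_quad A ^ n)"

definition tau :: "'n \<Rightarrow> 'n::{finite,linorder} form" where
  "tau x = fun_form (\<lambda>p. phi x p * phi_bar x p) + psi x * psi_bar x"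

text \<open>
  Forms do not commute in general, so a product over a set is taken in increasing order; for even
  forms such as \<open>1 + tau x\<close> the order is irrelevant.
\<close>

definition ordered_prod :: "('i::linorder \<Rightarrow> 'a::monoid_mult) \<Rightarrow> 'i set \<Rightarrow> 'a" where
  "ordered_prod f X = prod_list (map f (sorted_list_of_set X))"

end

theory Submission
  imports Defs "HOL-Probability.Distributions"
begin

text \<open>
  Write \<open>\<phi>*\<close> and \<open>\<psi>*\<close> for the conjugate fields, \<open>C = A\<^sup>-\<^sup>1\<close>, \<open>E(F) = \<integral> e\<^bsup>-S\<^esup> F\<close> for a form \<open>F\<close> with polynomial
  coefficients, and \<open>P\<^sub>X\<close> for the product of the \<open>1 + \<tau>\<^sub>x\<close> over \<open>x \<in> X\<close>. The proof is integration by parts, done in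
  parallel for the bosonic and the fermionic variables.

  The derivatives of \<open>e\<^bsup>-S\<^esup>\<close> in \<open>\<phi>\<^sub>z\<close> and \<open>\<psi>\<^sub>z\<close> are \<open>- \<Sum>\<^sub>y A\<^sub>z\<^sub>y \<phi>*\<^sub>y e\<^bsup>-S\<^esup>\<close> and \<open>- \<Sum>\<^sub>y A\<^sub>z\<^sub>y \<psi>*\<^sub>y e\<^bsup>-S\<^esup>\<close>, and
  derivatives integrate to zero: in \<open>\<phi>\<^sub>z\<close> because Lebesgue measure is translation invariant, in \<open>\<psi>\<^sub>z\<close> because a
  contraction has no part of top degree. Solving for \<open>\<phi>*\<close> and \<open>\<psi>*\<close> gives
  \<open>E(\<phi>*\<^sub>a F) = \<Sum>\<^sub>z C\<^sub>a\<^sub>z E(\<partial>F/\<partial>\<phi>\<^sub>z)\<close> and \<open>E(\<psi>*\<^sub>a F) = \<Sum>\<^sub>z C\<^sub>a\<^sub>z E(\<partial>F/\<partial>\<psi>\<^sub>z)\<close>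
  (\<open>super_expectation_phi_bar\<close>, \<open>super_expectation_psi_bar\<close>). The product \<open>P\<^sub>X\<close> looks the same to both derivatives: for
  \<open>z \<in> X\<close> they turn it into \<open>\<phi>*\<^sub>z P\<^bsub>X - z\<^esub>\<close> and \<open>\<psi>*\<^sub>z P\<^bsub>X - z\<^esub>\<close>. Therefore, if \<open>b \<notin> X\<close>,
  \<open>E(\<phi>*\<^sub>a \<phi>\<^sub>b P\<^sub>X) = C\<^sub>a\<^sub>b E(P\<^sub>X) + \<Sum>\<^bsub>x \<in> X\<^esub> C\<^sub>a\<^sub>x E(\<phi>*\<^sub>x \<phi>\<^sub>b P\<^bsub>X - x\<^esub>)\<close>,
  and \<open>E(\<psi>*\<^sub>a \<psi>\<^sub>b P\<^sub>X)\<close> satisfies the same recursion.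

  Hence the two expectations agree (\<open>boson_fermion_cancel\<close>), and since \<open>\<tau>\<^sub>x = \<phi>*\<^sub>x \<phi>\<^sub>x - \<psi>*\<^sub>x \<psi>\<^sub>x\<close>, the factors \<open>1 + \<tau>\<^sub>x\<close> can
  be removed from \<open>E(P\<^sub>X)\<close> one by one: \<open>E(P\<^sub>X) = E(1)\<close>. The same cancellation shows that \<open>E(1)\<close> does not depend on
  \<open>A\<close>: along the segment from the identity matrix to \<open>A\<close> its derivative is a combination of the numbers
  \<open>E(\<phi>\<^sub>x \<phi>*\<^sub>y + \<psi>\<^sub>x \<psi>*\<^sub>y) = 0\<close>. For the identity matrix \<open>E(1) = 1\<close> is the product of
  one-dimensional Gaussian integrals (\<open>super_expectation_one\<close>).

  With \<open>E(P\<^sub>X) = 1\<close> the recursion is the first-step decomposition of self-avoiding walks (\<open>walk_sum_step\<close>): a walk from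
  \<open>a\<close> to \<open>b\<close> with inner points in \<open>X\<close> either steps to \<open>b\<close> at once, or steps to some \<open>x \<in> X\<close> and goes on from there to \<open>b\<close>
  with inner points in \<open>X - x\<close>.
\<close>

section \<open>Coefficients of forms\<close>

lemma form_coeff_zero [simp]: "form_coeff 0 p S = 0"
  by (simp add: zero_form_def)

lemma form_coeff_one: "form_coeff 1 p S = (if S = {} then 1 else 0)"
  by (simp add: one_form_def)

lemma form_coeff_add [simp]: "form_coeff (\<omega> + \<eta>) p S = form_coeff \<omega> p S + form_coeff \<eta> p S"
  by (simp add: plus_form_def)

lemma form_coeff_diff [simp]: "form_coeff (\<omega> - \<eta>) p S = form_coeff \<omega> p S - form_coeff \<eta> p S"
  by (simp add: minus_form_def)

lemma form_coeff_uminus [simp]: "form_coeff (- \<omega>) p S = - form_coeff \<omega> p S"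
  by (simp add: uminus_form_def)

lemma form_coeff_sum [simp]: "form_coeff (\<Sum>i\<in>I. \<omega> i) p S = (\<Sum>i\<in>I. form_coeff (\<omega> i) p S)"
  by (induction I rule: infinite_finite_induct) auto

lemma form_coeff_mult:
  "form_coeff (\<omega> * \<eta>) p S =
     (\<Sum>T\<in>Pow S. wedge_sign T (S - T) * form_coeff \<omega> p T * form_coeff \<eta> p (S - T))"
  by (simp add: times_form_def)

lemma form_coeff_fun_form: "form_coeff (fun_form f) p S = (if S = {} then f p else 0)"
  by (simp add: fun_form_def)

lemma form_coeff_fun_form_mult [simp]:
  fixes \<omega> :: "'n::{finite,linorder} form"
  shows "form_coeff (fun_form f * \<omega>) p S = f p * form_coeff \<omega> p S"
proof -
  have "form_coeff (fun_form f * \<omega>) p S = (\<Sum>T\<in>Pow S. if T = {} then f p * form_coeff \<omega> p S else 0)"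
    unfolding form_coeff_mult form_coeff_fun_form by (rule sum.cong) auto
  then show ?thesis by simp
qed

lemma form_coeff_mult_fun_form [simp]:
  fixes \<omega> :: "'n::{finite,linorder} form"
  shows "form_coeff (\<omega> * fun_form f) p S = f p * form_coeff \<omega> p S"
proof -
  have "form_coeff (\<omega> * fun_form f) p S = (\<Sum>T\<in>Pow S. if T = S then f p * form_coeff \<omega> p S else 0)"
    unfolding form_coeff_mult form_coeff_fun_form by (rule sum.cong) auto
  then show ?thesis by simp
qed

lemma fun_form_commute: "\<omega> * fun_form f = fun_form f * (\<omega> :: 'n::{finite,linorder} form)"
  by (rule form_eqI) simp

lemma fun_form_mult: "fun_form (\<lambda>p. f p * g p) = (fun_form f * fun_form g :: 'n::{finite,linorder} form)"
  by (rule form_eqI) (simp add: form_coeff_fun_form)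

lemma fun_form_mult_assoc:
  "fun_form f * (fun_form g * \<omega>) = fun_form (\<lambda>p. f p * g p) * (\<omega> :: 'n::{finite,linorder} form)"
  by (simp add: fun_form_mult mult.assoc)

lemma fun_form_left_commute: "\<omega> * (fun_form f * \<eta>) = fun_form f * (\<omega> * (\<eta> :: 'n::{finite,linorder} form))"
  by (metis fun_form_commute mult.assoc)

lemma one_form_eq: "(1 :: 'n::{finite,linorder} form) = const_form 1"
  by (rule form_eqI) (simp add: form_coeff_fun_form form_coeff_one)

section \<open>Grading and contraction\<close>

text \<open>
  The automorphism that is \<open>1\<close> on even forms and \<open>-1\<close> on odd forms. It carries the signs in the Leibniz rule for
  contractions; a form is even if it is fixed by it.
\<close>

definition grade_inv :: "'n::finite form \<Rightarrow> 'n form" where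
  "grade_inv \<omega> = Form (\<lambda>p S. (-1) ^ card S * form_coeff \<omega> p S)"

text \<open>
  Interior multiplication with the coordinate vector field of \<open>c\<close>, the antiderivation that takes the differential of \<open>c\<close>
  to \<open>1\<close> and all the other coordinate differentials to \<open>0\<close>.
\<close>

definition contract :: "'n::{finite,linorder} coord \<Rightarrow> 'n form \<Rightarrow> 'n form" where
  "contract c \<omega> = Form (\<lambda>p S. if c \<in> S then 0 else wedge_sign {c} S * form_coeff \<omega> p (insert c S))"

lemma form_coeff_grade_inv [simp]: "form_coeff (grade_inv \<omega>) p S = (-1) ^ card S * form_coeff \<omega> p S"
  by (simp add: grade_inv_def)

lemma form_coeff_contract:
  "form_coeff (contract c \<omega>) p S = (if c \<in> S then 0 else wedge_sign {c} S * form_coeff \<omega> p (insert c S))"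
  by (simp add: contract_def)

lemma wedge_sign_square: "wedge_sign S T * wedge_sign S T = 1"
  unfolding wedge_sign_def power_mult_distrib[symmetric] by simp

text \<open>
  Of the pairs in \<open>S \<times> T\<close>, those that are inversions for \<open>S T\<close> are exactly those that are not inversions for \<open>T S\<close>.
\<close>

lemma wedge_sign_swap:
  fixes S T :: "'n::{finite,linorder} coord set"
  assumes "S \<inter> T = {}"
  shows "wedge_sign S T = (-1) ^ (card S * card T) * wedge_sign T S"
proof -
  let ?P = "{(s, t). s \<in> S \<and> t \<in> T \<and> precedes t s}"
  let ?R = "{(s, t). s \<in> S \<and> t \<in> T \<and> precedes s t}"
  have R: "card {(t, s). t \<in> T \<and> s \<in> S \<and> precedes s t} = card ?R"
    by (rule bij_betw_same_card[of prod.swap], rule bij_betwI[where g = prod.swap]) auto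
  have "precedes s t \<longleftrightarrow> \<not> precedes t s" if "s \<in> S" "t \<in> T" for s t
    using that assms by (intro precedes_total) auto
  then have "?P \<union> ?R = S \<times> T" "?P \<inter> ?R = {}"
    by auto
  then have "card ?P + card ?R = card S * card T"
    using card_Un_disjoint[of ?P ?R] by (simp add: card_cartesian_product)
  then have "wedge_sign S T * wedge_sign T S = (-1) ^ (card S * card T)"
    unfolding wedge_sign_def R power_add[symmetric] by simp
  then have "wedge_sign S T * (wedge_sign T S * wedge_sign T S) = (-1) ^ (card S * card T) * wedge_sign T S"
    unfolding mult.assoc[symmetric] by simp
  then show ?thesis
    unfolding wedge_sign_square by simp
qed

lemma grade_inv_mult: "grade_inv (\<omega> * \<eta>) = grade_inv \<omega> * grade_inv (\<eta> :: 'n::{finite,linorder} form)"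
proof (rule form_eqI)
  fix p and S :: "'n coord set"
  have sign: "(-1 :: complex) ^ card S = (-1) ^ card T * (-1) ^ card (S - T)" if "T \<subseteq> S" for T
    using card_Un_disjoint[of T "S - T"] that by (simp add: Un_absorb1 flip: power_add)
  have "form_coeff (grade_inv (\<omega> * \<eta>)) p S =
      (\<Sum>T\<in>Pow S. (-1) ^ card S * (wedge_sign T (S - T) * form_coeff \<omega> p T * form_coeff \<eta> p (S - T)))"
    by (simp add: form_coeff_mult sum_distrib_left)
  also have "\<dots> = form_coeff (grade_inv \<omega> * grade_inv \<eta>) p S"
    unfolding form_coeff_mult form_coeff_grade_inv
    by (rule sum.cong) (simp_all add: sign mult_ac)
  finally show "form_coeff (grade_inv (\<omega> * \<eta>)) p S = form_coeff (grade_inv \<omega> * grade_inv \<eta>) p S" .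
qed

lemma grade_inv_add [simp]: "grade_inv (\<omega> + \<eta>) = grade_inv \<omega> + grade_inv (\<eta> :: 'n::{finite,linorder} form)"
  by (rule form_eqI) (simp add: algebra_simps)

lemma grade_inv_uminus [simp]: "grade_inv (- \<omega>) = - grade_inv (\<omega> :: 'n::{finite,linorder} form)"
  by (rule form_eqI) simp

lemma grade_inv_diff [simp]: "grade_inv (\<omega> - \<eta>) = grade_inv \<omega> - grade_inv (\<eta> :: 'n::{finite,linorder} form)"
  by (rule form_eqI) (simp add: algebra_simps)

lemma grade_inv_sum [simp]:
  "grade_inv (\<Sum>i\<in>I. \<omega> i) = (\<Sum>i\<in>I. grade_inv (\<omega> i :: 'n::{finite,linorder} form))"
  by (rule form_eqI) (simp add: sum_distrib_left)

lemma grade_inv_fun_form [simp]: "grade_inv (fun_form f) = fun_form f"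
  by (rule form_eqI) (simp add: form_coeff_fun_form)

lemma grade_inv_one [simp]: "grade_inv 1 = (1 :: 'n::{finite,linorder} form)"
  by (simp add: one_form_eq)

lemma grade_inv_coord_diff [simp]: "grade_inv (coord_diff c) = - coord_diff (c :: 'n::{finite,linorder} coord)"
  by (rule form_eqI) (simp add: coord_diff_def)

lemma grade_inv_psi [simp]: "grade_inv (psi x) = - psi x" "grade_inv (psi_bar x) = - psi_bar x"
  by (simp_all add: psi_def psi_bar_def dphi_def dphi_bar_def grade_inv_mult algebra_simps)

lemma even_form_commute:
  fixes \<omega> \<eta> :: "'n::{finite,linorder} form"
  assumes "grade_inv \<omega> = \<omega>"
  shows "\<omega> * \<eta> = \<eta> * \<omega>"
proof (rule form_eqI)
  fix p and S :: "'n coord set"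
  have odd0: "form_coeff \<omega> p T = 0" if "odd (card T)" for T
    using arg_cong[OF assms, of "\<lambda>\<omega>. form_coeff \<omega> p T"] that by simp
  have "form_coeff (\<omega> * \<eta>) p S =
      (\<Sum>T\<in>Pow S. wedge_sign (S - T) T * form_coeff \<omega> p T * form_coeff \<eta> p (S - T))"
    unfolding form_coeff_mult
  proof (rule sum.cong)
    fix T
    show "wedge_sign T (S - T) * form_coeff \<omega> p T * form_coeff \<eta> p (S - T) =
        wedge_sign (S - T) T * form_coeff \<omega> p T * form_coeff \<eta> p (S - T)"
      using odd0[of T] wedge_sign_swap[of T "S - T"] by (cases "even (card T)") auto
  qed simp
  also have "\<dots> = form_coeff (\<eta> * \<omega>) p S"
    unfolding form_coeff_mult
    by (rule sum.reindex_bij_witness[where i = "\<lambda>T. S - T" and j = "\<lambda>T. S - T"])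
       (auto simp: double_diff)
  finally show "form_coeff (\<omega> * \<eta>) p S = form_coeff (\<eta> * \<omega>) p S" .
qed

lemma grade_inv_power: "grade_inv \<omega> = \<omega> \<Longrightarrow> grade_inv (\<omega> ^ n) = (\<omega> ^ n :: 'n::{finite,linorder} form)"
  by (induction n) (simp_all add: grade_inv_mult)

text \<open>
  For \<open>c \<in> S\<close> the coefficient at \<open>S\<close> on the left is \<open>0\<close>. On the right, the first product contributes the subsets that miss
  \<open>c\<close> and the second one those that contain \<open>c\<close>, and adding \<open>c\<close> to a subset matches them with opposite signs. For
  \<open>c \<notin> S\<close> the subsets of \<open>S \<union> {c}\<close> that contain \<open>c\<close> give the first product and the others the second.
\<close>

lemma contract_mult:
  fixes \<omega> \<eta> :: "'n::{finite,linorder} form"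
  shows "contract c (\<omega> * \<eta>) = contract c \<omega> * \<eta> + grade_inv \<omega> * contract c \<eta>"
proof (rule form_eqI)
  fix p and S :: "'n coord set"
  show "form_coeff (contract c (\<omega> * \<eta>)) p S = form_coeff (contract c \<omega> * \<eta> + grade_inv \<omega> * contract c \<eta>) p S"
  proof (cases "c \<in> S")
    case True
    have "form_coeff (contract c \<omega> * \<eta>) p S = (\<Sum>T\<in>Pow (S - {c}). wedge_sign T (S - T) *
        (wedge_sign {c} T * form_coeff \<omega> p (insert c T)) * form_coeff \<eta> p (S - T))"
      unfolding form_coeff_mult form_coeff_contract
      by (rule sum.mono_neutral_cong_right) auto
    also have "\<dots> = (\<Sum>T\<in>Pow (S - {c}). - (wedge_sign (insert c T) (S - insert c T) * ((-1) ^ card (insert c T) * form_coeff \<omega> p (insert c T)) *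
        (wedge_sign {c} (S - insert c T) * form_coeff \<eta> p (S - T))))"
    proof (rule sum.cong)
      fix T assume T: "T \<in> Pow (S - {c})"
      have e: "S - T = {c} \<union> (S - insert c T)"
        using T True by auto
      have 1: "wedge_sign T (S - T) = wedge_sign T {c} * wedge_sign T (S - insert c T)"
        unfolding e by (rule wedge_sign_Un_right) auto
      have 2: "wedge_sign (insert c T) (S - insert c T) = wedge_sign {c} (S - insert c T) * wedge_sign T (S - insert c T)"
        using T wedge_sign_Un_left[of "{c}" T "S - insert c T"] by auto
      have 3: "wedge_sign T {c} * wedge_sign {c} T = (-1) ^ card T"
      proof -
        have "wedge_sign T {c} = (-1) ^ card T * wedge_sign {c} T"
          using wedge_sign_swap[of T "{c}"] T by auto
        moreover have "wedge_sign {c} T * wedge_sign {c} T = 1"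
          by (rule wedge_sign_square)
        ultimately show ?thesis by (simp add: mult.assoc)
      qed
      have 4: "wedge_sign {c} (S - insert c T) * wedge_sign {c} (S - insert c T) = 1"
        by (rule wedge_sign_square)
      have 5: "card (insert c T) = Suc (card T)"
        using T by (subst card_insert_disjoint) auto
      have "wedge_sign T (S - T) * (wedge_sign {c} T * form_coeff \<omega> p (insert c T)) * form_coeff \<eta> p (S - T)
        = (wedge_sign T {c} * wedge_sign {c} T) * wedge_sign T (S - insert c T) * form_coeff \<omega> p (insert c T) * form_coeff \<eta> p (S - T)"
        unfolding 1 by (simp add: mult_ac)
      also have "\<dots> = (wedge_sign {c} (S - insert c T) * wedge_sign {c} (S - insert c T)) * 
          ((-1) ^ card T * wedge_sign T (S - insert c T) * form_coeff \<omega> p (insert c T) * form_coeff \<eta> p (S - T))"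
        unfolding 3 4 by simp
      finally show "wedge_sign T (S - T) * (wedge_sign {c} T * form_coeff \<omega> p (insert c T)) * form_coeff \<eta> p (S - T)
       = - (wedge_sign (insert c T) (S - insert c T) * ((-1) ^ card (insert c T) * form_coeff \<omega> p (insert c T)) *
        (wedge_sign {c} (S - insert c T) * form_coeff \<eta> p (S - T)))"
        unfolding 2 5 by (simp add: mult_ac)
    qed simp
    also have "\<dots> = - (\<Sum>T\<in>Pow S. wedge_sign T (S - T) * ((-1) ^ card T * form_coeff \<omega> p T) *
        form_coeff (contract c \<eta>) p (S - T))"
      unfolding sum_negf form_coeff_contract neg_equal_iff_equal
      by (rule sum.reindex_bij_witness_not_neutral[where i = "\<lambda>T. T - {c}" and j = "insert c" 
            and S' = "{}" and T' = "{T \<in> Pow S. c \<notin> T}"])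
         (use True in \<open>auto simp: insert_absorb insert_Diff_if split: if_splits intro!: arg_cong[where f = "form_coeff \<eta> p"]\<close>)
    finally show ?thesis
      using True by (simp add: form_coeff_contract[of c "\<omega> * \<eta>"] form_coeff_mult)
  next
    case False
    have Pow: "Pow (insert c S) = Pow S \<union> insert c ` Pow S" "Pow S \<inter> insert c ` Pow S = {}"
      "inj_on (insert c) (Pow S)"
      using False by (auto simp: Pow_insert inj_on_def)
    have l: "wedge_sign {c} S * (wedge_sign T (insert c S - T) * form_coeff \<omega> p T * form_coeff \<eta> p (insert c S - T)) =
        wedge_sign T (S - T) * form_coeff (grade_inv \<omega>) p T * form_coeff (contract c \<eta>) p (S - T)"
      if T: "T \<in> Pow S" for T
    proof -
      have e: "insert c S - T = {c} \<union> (S - T)" and "c \<notin> T"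
        using T False by auto
      have 1: "wedge_sign T (insert c S - T) = wedge_sign T {c} * wedge_sign T (S - T)"
        unfolding e using False by (intro wedge_sign_Un_right) auto
      have 2: "wedge_sign {c} S = wedge_sign {c} T * wedge_sign {c} (S - T)"
        using wedge_sign_Un_right[of T "S - T" "{c}"] T by (simp add: Un_absorb1)
      have 3: "wedge_sign {c} T * wedge_sign T {c} = (-1) ^ card T"
      proof -
        have "wedge_sign T {c} = (-1) ^ card T * wedge_sign {c} T"
          using wedge_sign_swap[of T "{c}"] \<open>c \<notin> T\<close> by auto
        moreover have "wedge_sign {c} T * wedge_sign {c} T = 1"
          by (rule wedge_sign_square)
        ultimately show ?thesis by (simp add: mult.left_commute)
      qed
      have "wedge_sign {c} S * (wedge_sign T (insert c S - T) * form_coeff \<omega> p T * form_coeff \<eta> p (insert c S - T))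
        = (wedge_sign {c} T * wedge_sign T {c}) * (wedge_sign T (S - T) * form_coeff \<omega> p T * (wedge_sign {c} (S - T) * form_coeff \<eta> p (insert c S - T)))"
        unfolding 1 2 by (simp add: mult_ac)
      also have "\<dots> = wedge_sign T (S - T) * form_coeff (grade_inv \<omega>) p T * form_coeff (contract c \<eta>) p (S - T)"
        unfolding 3 using False e by (simp add: form_coeff_contract mult_ac)
      finally show ?thesis .
    qed
    have r: "wedge_sign {c} S * (wedge_sign (insert c T) (insert c S - insert c T) * form_coeff \<omega> p (insert c T) * form_coeff \<eta> p (insert c S - insert c T)) =
        wedge_sign T (S - T) * form_coeff (contract c \<omega>) p T * form_coeff \<eta> p (S - T)"
      if T: "T \<in> Pow S" for T
    proof -
      have e: "insert c S - insert c T = S - T" and "c \<notin> T"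
        using T False by auto
      have 1: "wedge_sign (insert c T) (S - T) = wedge_sign {c} (S - T) * wedge_sign T (S - T)"
        using wedge_sign_Un_left[of "{c}" T "S - T"] \<open>c \<notin> T\<close> by auto
      have 2: "wedge_sign {c} S = wedge_sign {c} T * wedge_sign {c} (S - T)"
        using wedge_sign_Un_right[of T "S - T" "{c}"] T by (simp add: Un_absorb1)
      have 3: "wedge_sign {c} (S - T) * wedge_sign {c} (S - T) = 1"
        by (rule wedge_sign_square)
      have "wedge_sign {c} S * (wedge_sign (insert c T) (insert c S - insert c T) * form_coeff \<omega> p (insert c T) * form_coeff \<eta> p (insert c S - insert c T))
        = (wedge_sign {c} (S - T) * wedge_sign {c} (S - T)) * (wedge_sign T (S - T) * (wedge_sign {c} T * form_coeff \<omega> p (insert c T)) * form_coeff \<eta> p (S - T))"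
        unfolding e 1 2 by (simp add: mult_ac)
      then show ?thesis
        unfolding 3 using \<open>c \<notin> T\<close> by (simp add: form_coeff_contract mult_ac)
    qed
    have "form_coeff (contract c (\<omega> * \<eta>)) p S = wedge_sign {c} S * (\<Sum>T\<in>Pow (insert c S). wedge_sign T (insert c S - T) * form_coeff \<omega> p T * form_coeff \<eta> p (insert c S - T))"
      using False by (simp add: form_coeff_contract form_coeff_mult)
    also have "\<dots> = form_coeff (grade_inv \<omega> * contract c \<eta>) p S + form_coeff (contract c \<omega> * \<eta>) p S"
      unfolding Pow(1) sum.union_disjoint[OF finite finite Pow(2)] sum.reindex[OF Pow(3)] o_def
        distrib_left sum_distrib_left form_coeff_mult
      using l r by (intro arg_cong2[where f = "(+)"] sum.cong) auto
    finally show ?thesis by simp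
  qed
qed

lemma contract_add [simp]: "contract c (\<omega> + \<eta>) = contract c \<omega> + contract c (\<eta> :: 'n::{finite,linorder} form)"
  by (rule form_eqI) (simp add: form_coeff_contract algebra_simps)

lemma contract_uminus [simp]: "contract c (- \<omega>) = - contract c (\<omega> :: 'n::{finite,linorder} form)"
  by (rule form_eqI) (simp add: form_coeff_contract)

lemma contract_diff [simp]: "contract c (\<omega> - \<eta>) = contract c \<omega> - contract c (\<eta> :: 'n::{finite,linorder} form)"
  by (rule form_eqI) (simp add: form_coeff_contract algebra_simps)

lemma contract_sum [simp]:
  "contract c (\<Sum>i\<in>I. \<omega> i) = (\<Sum>i\<in>I. contract c (\<omega> i :: 'n::{finite,linorder} form))"
  by (rule form_eqI) (simp add: form_coeff_contract sum_distrib_left)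

lemma contract_fun_form [simp]: "contract c (fun_form f) = (0 :: 'n::{finite,linorder} form)"
  by (rule form_eqI) (simp add: form_coeff_contract form_coeff_fun_form)

lemma contract_fun_form_mult [simp]:
  "contract c (fun_form f * \<omega>) = fun_form f * contract c (\<omega> :: 'n::{finite,linorder} form)"
  by (simp add: contract_mult)

lemma contract_coord_diff [simp]:
  "contract c (coord_diff d) = (if c = d then 1 else 0 :: 'n::{finite,linorder} form)"
  by (rule form_eqI) (auto simp: form_coeff_contract coord_diff_def form_coeff_one)

section \<open>Gaussian integrals of polynomials\<close>

text \<open>
  Polynomial functions with complex coefficients on a real space; the class is closed under directional derivatives
  and grows slowly enough to be integrable against a Gaussian.
\<close>

inductive cpoly :: "('a::real_normed_vector \<Rightarrow> complex) \<Rightarrow> bool" where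
  cpoly_const [intro]: "cpoly (\<lambda>p. c)"
| cpoly_linear: "bounded_linear f \<Longrightarrow> cpoly f"
| cpoly_add [intro]: "cpoly f \<Longrightarrow> cpoly g \<Longrightarrow> cpoly (\<lambda>p. f p + g p)"
| cpoly_mult [intro]: "cpoly f \<Longrightarrow> cpoly g \<Longrightarrow> cpoly (\<lambda>p. f p * g p)"

lemma cpoly_sum: "(\<And>i. i \<in> I \<Longrightarrow> cpoly (f i)) \<Longrightarrow> cpoly (\<lambda>p. \<Sum>i\<in>I. f i p)"
  by (induction I rule: infinite_finite_induct) (auto intro: cpoly_const)

lemma cpoly_uminus: "cpoly f \<Longrightarrow> cpoly (\<lambda>p. - f p)"
  using cpoly_mult[OF cpoly_const[of "-1"], of f] by simp

lemma cpoly_diff: "cpoly f \<Longrightarrow> cpoly g \<Longrightarrow> cpoly (\<lambda>p. f p - g p)"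
  using cpoly_add[OF _ cpoly_uminus, of f g] by simp

lemma cpoly_growth: "cpoly f \<Longrightarrow> \<exists>K\<ge>0. \<exists>k. \<forall>p. norm (f p) \<le> K * (1 + norm p) ^ k"
proof (induction rule: cpoly.induct)
  case (cpoly_const c)
  show ?case by (rule exI[of _ "norm c"], simp, rule exI[of _ 0], simp)
next
  case (cpoly_linear f)
  then obtain K where K: "0 \<le> K" "\<And>p. norm (f p) \<le> norm p * K"
    using bounded_linear.nonneg_bounded by blast
  have "norm (f p) \<le> K * (1 + norm p) ^ 1" for p
    using K(2)[of p] K(1) by (simp add: algebra_simps)
  then show ?case using K(1) by blast
next
  case (cpoly_add f g)
  then obtain K k L l where K: "0 \<le> K" "\<And>p. norm (f p) \<le> K * (1 + norm p) ^ k"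
    and L: "0 \<le> L" "\<And>p. norm (g p) \<le> L * (1 + norm p) ^ l"
    by auto
  have "norm (f p + g p) \<le> (K + L) * (1 + norm p) ^ (k + l)" for p
  proof -
    have "norm (f p + g p) \<le> K * (1 + norm p) ^ k + L * (1 + norm p) ^ l"
      using K(2)[of p] L(2)[of p] norm_triangle_ineq[of "f p" "g p"] by linarith
    also have "\<dots> \<le> K * (1 + norm p) ^ (k + l) + L * (1 + norm p) ^ (k + l)"
      using K(1) L(1) by (intro add_mono mult_left_mono power_increasing) auto
    finally show ?thesis by (simp add: algebra_simps)
  qed
  then show ?case using K(1) L(1) by (metis add_nonneg_nonneg)
next
  case (cpoly_mult f g)
  then obtain K k L l where K: "0 \<le> K" "\<And>p. norm (f p) \<le> K * (1 + norm p) ^ k"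
    and L: "0 \<le> L" "\<And>p. norm (g p) \<le> L * (1 + norm p) ^ l"
    by auto
  have "norm (f p * g p) \<le> (K * L) * (1 + norm p) ^ (k + l)" for p
  proof -
    have "norm (f p) * norm (g p) \<le> (K * (1 + norm p) ^ k) * (L * (1 + norm p) ^ l)"
      using K L by (intro mult_mono) auto
    then show ?thesis by (simp add: norm_mult power_add mult_ac)
  qed
  then show ?case using K(1) L(1) by (metis mult_nonneg_nonneg)
qed

lemma cpoly_has_derivative:
  "cpoly f \<Longrightarrow> \<exists>f'. (\<forall>p. (f has_derivative f' p) (at p)) \<and> (\<forall>e. cpoly (\<lambda>p. f' p e))"
proof (induction rule: cpoly.induct)
  case (cpoly_const c)
  show ?case by (rule exI[of _ "\<lambda>p e. 0"]) (auto intro: cpoly.intros)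
next
  case (cpoly_linear f)
  show ?case
    by (rule exI[of _ "\<lambda>p e. f e"]) (auto intro: cpoly.intros bounded_linear_imp_has_derivative[OF cpoly_linear])
next
  case (cpoly_add f g)
  then obtain f' g' where "\<forall>p. (f has_derivative f' p) (at p)" "\<forall>e. cpoly (\<lambda>p. f' p e)"
     "\<forall>p. (g has_derivative g' p) (at p)" "\<forall>e. cpoly (\<lambda>p. g' p e)" by auto
  then show ?case
    by (intro exI[of _ "\<lambda>p e. f' p e + g' p e"]) (auto intro: cpoly.intros has_derivative_add)
next
  case (cpoly_mult f g)
  then obtain f' g' where "\<forall>p. (f has_derivative f' p) (at p)" "\<forall>e. cpoly (\<lambda>p. f' p e)"
     "\<forall>p. (g has_derivative g' p) (at p)" "\<forall>e. cpoly (\<lambda>p. g' p e)" by auto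
  then show ?case
    using cpoly_mult.hyps
    by (intro exI[of _ "\<lambda>p e. f p * g' p e + f' p e * g p"])
       (auto intro!: cpoly.cpoly_add cpoly.cpoly_mult has_derivative_mult)
qed

lemma cpoly_frechet:
  assumes "cpoly f"
  shows cpoly_has_frechet_derivative: "(f has_derivative frechet_derivative f (at p)) (at p)"
    and cpoly_frechet_derivative: "cpoly (\<lambda>p. frechet_derivative f (at p) e)"
proof -
  obtain f' where f': "\<And>p. (f has_derivative f' p) (at p)" "\<And>e. cpoly (\<lambda>p. f' p e)"
    using cpoly_has_derivative[OF assms] by auto
  have "f' p = frechet_derivative f (at p)" for p
    by (rule frechet_derivative_at[OF f'(1)])
  then have eq: "f' = (\<lambda>p. frechet_derivative f (at p))"
    by auto
  show "(f has_derivative frechet_derivative f (at p)) (at p)"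
    "cpoly (\<lambda>p. frechet_derivative f (at p) e)"
    using f'[unfolded eq] by auto
qed

lemma cpoly_continuous: "cpoly f \<Longrightarrow> continuous_on S f"
  by (meson continuous_at_imp_continuous_on cpoly_has_frechet_derivative has_derivative_continuous)

lemma nn_integral_gaussian_real:
  assumes "c > 0"
  shows "(\<integral>\<^sup>+x. ennreal (exp (- c * x\<^sup>2)) \<partial>lborel) = ennreal (sqrt (pi / c))"
proof -
  define s where "s = sqrt (1 / (2 * c))"
  have s: "s > 0" "s\<^sup>2 = 1 / (2 * c)" using assms by (auto simp: s_def)
  have e: "exp (- c * x\<^sup>2) = sqrt (pi / c) * normal_density 0 s x" for x
    using assms by (simp add: normal_density_def s mult_ac)
  have "has_bochner_integral lborel (\<lambda>x. exp (- c * x\<^sup>2)) (sqrt (pi / c) * 1)"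
    unfolding e using s(1)
    by (intro has_bochner_integral_mult_right)
       (simp add: has_bochner_integral_iff integrable_normal_density integral_normal_density)
  then show ?thesis
    by (simp add: nn_integral_eq_integral has_bochner_integral_iff)
qed

lemma has_bochner_integral_gaussian:
  fixes c :: real
  assumes "c > 0"
  shows "has_bochner_integral lborel (\<lambda>x::'a::euclidean_space. exp (- c * (norm x)\<^sup>2)) (sqrt (pi / c) ^ DIM('a))"
proof (rule has_bochner_integral_nn_integral)
  have e: "exp (- c * (norm x)\<^sup>2) = (\<Prod>b\<in>Basis. exp (- c * (x \<bullet> b)\<^sup>2))" for x :: 'a
  proof -
    have "- c * (norm x)\<^sup>2 = (\<Sum>b\<in>Basis. - c * (x \<bullet> b)\<^sup>2)"
      unfolding power2_norm_eq_inner by (subst euclidean_inner) (simp add: sum_distrib_left power2_eq_square)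
    then show ?thesis by (simp only: exp_sum finite_Basis)
  qed
  have "(\<integral>\<^sup>+x. ennreal (exp (- c * (norm (x::'a))\<^sup>2)) \<partial>lborel) = (\<integral>\<^sup>+x. (\<Prod>b\<in>Basis. ennreal (exp (- c * ((x::'a) \<bullet> b)\<^sup>2))) \<partial>lborel)"
    unfolding e by (simp add: prod_ennreal)
  also have "\<dots> = ennreal (sqrt (pi / c) ^ DIM('a))"
    using assms by (subst nn_integral_lborel_prod) (simp_all add: nn_integral_gaussian_real[simplified] ennreal_power)
  finally show "(\<integral>\<^sup>+x. ennreal (exp (- c * (norm (x::'a))\<^sup>2)) \<partial>lborel) = ennreal (sqrt (pi / c) ^ DIM('a))" .
qed (use assms in auto)

text \<open>
  Half of the Gaussian decay absorbs the polynomial, because \<open>(1 + r)\<^sup>k \<le> e\<^bsup>k r\<^esup>\<close> and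
  \<open>k r \<le> k\<^sup>2 / (2 c) + (c / 2) r\<^sup>2\<close>.
\<close>

lemma gaussian_cpoly_bound:
  assumes "cpoly q" "c > 0"
  shows "\<exists>K\<ge>0. \<forall>p. exp (- c * (norm p)\<^sup>2) * norm (q p) \<le> K * exp (- (c / 2) * (norm p)\<^sup>2)"
proof -
  obtain K k where K: "0 \<le> K" "\<And>p. norm (q p) \<le> K * (1 + norm p) ^ k"
    using cpoly_growth[OF assms(1)] by auto
  define L where "L = exp ((real k)\<^sup>2 / (2 * c))"
  have "exp (- c * (norm p)\<^sup>2) * norm (q p) \<le> K * L * exp (- (c / 2) * (norm p)\<^sup>2)" for p
  proof -
    have "(1 + norm p) ^ k \<le> exp (norm p) ^ k"
      by (intro power_mono) auto
    also have "\<dots> = exp (real k * norm p)"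
      by (simp add: exp_of_nat_mult)
    also have "\<dots> \<le> exp ((real k)\<^sup>2 / (2 * c) + (c / 2) * (norm p)\<^sup>2)"
    proof -
      \<comment> \<open>Completing the square.\<close>
      have "0 \<le> (c * norm p - real k)\<^sup>2 / (2 * c)"
        using assms(2) by simp
      also have "\<dots> = (real k)\<^sup>2 / (2 * c) + (c / 2) * (norm p)\<^sup>2 - real k * norm p"
        using assms(2) by (simp add: field_simps power2_eq_square)
      finally show ?thesis by simp
    qed
    finally have "(1 + norm p) ^ k \<le> L * exp ((c / 2) * (norm p)\<^sup>2)"
      by (simp add: L_def exp_add)
    then have "norm (q p) \<le> K * (L * exp ((c / 2) * (norm p)\<^sup>2))"
      using K(2)[of p] mult_left_mono[OF _ K(1)] order_trans by blast
    then have "exp (- c * (norm p)\<^sup>2) * norm (q p) \<le> exp (- c * (norm p)\<^sup>2) * (K * (L * exp ((c / 2) * (norm p)\<^sup>2)))"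
      by (rule mult_left_mono) simp
    also have "\<dots> = K * L * (exp (- c * (norm p)\<^sup>2) * exp ((c / 2) * (norm p)\<^sup>2))"
      by (simp only: mult_ac)
    also have "exp (- c * (norm p)\<^sup>2) * exp ((c / 2) * (norm p)\<^sup>2) = exp (- (c / 2) * (norm p)\<^sup>2)"
      by (simp flip: exp_add add: field_simps)
    finally show ?thesis .
  qed
  moreover have "0 \<le> K * L" using K(1) by (simp add: L_def)
  ultimately show ?thesis by blast
qed

lemma has_vector_derivative_iff_quotient:
  fixes f :: "real \<Rightarrow> 'a::real_normed_vector"
  shows "(f has_vector_derivative D) (at x within S) \<longleftrightarrow>
    ((\<lambda>y. (1 / (y - x)) *\<^sub>R (f y - f x)) \<longlongrightarrow> D) (at x within S)"
proof -
  have "norm ((f y - f x) - (y - x) *\<^sub>R D) / norm (y - x) = norm ((1 / (y - x)) *\<^sub>R (f y - f x) - D)"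
    if "y \<noteq> x" for y
  proof -
    have "(1 / (y - x)) *\<^sub>R (f y - f x) - D = (1 / (y - x)) *\<^sub>R ((f y - f x) - (y - x) *\<^sub>R D)"
      using that by (simp add: scaleR_diff_right)
    then show ?thesis by simp
  qed
  then have "((\<lambda>y. norm ((f y - f x) - (y - x) *\<^sub>R D) / norm (y - x)) \<longlongrightarrow> 0) (at x within S) \<longleftrightarrow>
      ((\<lambda>y. norm ((1 / (y - x)) *\<^sub>R (f y - f x) - D)) \<longlongrightarrow> 0) (at x within S)"
    by (intro filterlim_cong) (auto simp: eventually_at_filter)
  then show ?thesis
    unfolding has_vector_derivative_def has_derivative_iff_norm tendsto_norm_zero_iff LIM_zero_iff
    by (simp add: bounded_linear_scaleR_left)
qed

text \<open>
  Differentiation under the integral sign: by the mean value theorem \<open>G\<close> also dominates the difference quotients.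
\<close>

lemma has_vector_derivative_integral:
  fixes F F' :: "real \<Rightarrow> 'a::euclidean_space \<Rightarrow> complex"
  assumes deriv: "\<And>s p. s \<in> {0..1} \<Longrightarrow> ((\<lambda>s. F s p) has_vector_derivative F' s p) (at s within {0..1})"
    and F: "\<And>s. s \<in> {0..1} \<Longrightarrow> integrable lborel (F s)"
    and F': "\<And>s. s \<in> {0..1} \<Longrightarrow> F' s \<in> borel_measurable lborel"
    and bound: "\<And>s p. s \<in> {0..1} \<Longrightarrow> norm (F' s p) \<le> G p"
    and G: "integrable lborel G" and t: "t \<in> {0..1}"
  shows "((\<lambda>s. \<integral>p. F s p \<partial>lborel) has_vector_derivative (\<integral>p. F' t p \<partial>lborel)) (at t within {0..1})"
  unfolding has_vector_derivative_iff_quotient tendsto_at_iff_sequentially o_def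
proof (intro allI impI)
    fix X :: "nat \<Rightarrow> real"
    assume X: "\<forall>i. X i \<in> {0..1} - {t}" "X \<longlonglongrightarrow> t"
    have eq: "(1 / (X i - t)) *\<^sub>R ((\<integral>p. F (X i) p \<partial>lborel) - (\<integral>p. F t p \<partial>lborel)) =
        (\<integral>p. (1 / (X i - t)) *\<^sub>R (F (X i) p - F t p) \<partial>lborel)" for i
      using X(1) F t by (subst integral_scaleR_right, subst Bochner_Integration.integral_diff) auto
    show "(\<lambda>i. (1 / (X i - t)) *\<^sub>R ((\<integral>p. F (X i) p \<partial>lborel) - (\<integral>p. F t p \<partial>lborel))) \<longlonglongrightarrow> (\<integral>p. F' t p \<partial>lborel)"
      unfolding eq
    proof (rule integral_dominated_convergence[where w = G])
      show "F' t \<in> borel_measurable lborel" "integrable lborel G" using F' G t by auto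
      show "(\<lambda>p. (1 / (X i - t)) *\<^sub>R (F (X i) p - F t p)) \<in> borel_measurable lborel" for i
        using F[of "X i"] F[OF t] X(1) by (intro borel_measurable_scaleR borel_measurable_diff) auto
      show "AE p in lborel. (\<lambda>i. (1 / (X i - t)) *\<^sub>R (F (X i) p - F t p)) \<longlonglongrightarrow> F' t p"
      proof (rule AE_I2)
        fix p
        have "((\<lambda>s. (1 / (s - t)) *\<^sub>R (F s p - F t p)) \<longlongrightarrow> F' t p) (at t within {0..1})"
          using deriv[OF t, of p] unfolding has_vector_derivative_iff_quotient .
        then show "(\<lambda>i. (1 / (X i - t)) *\<^sub>R (F (X i) p - F t p)) \<longlonglongrightarrow> F' t p"
          using X unfolding tendsto_at_iff_sequentially o_def by blast
      qed
      show "AE p in lborel. norm ((1 / (X i - t)) *\<^sub>R (F (X i) p - F t p)) \<le> G p" for i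
      proof (rule AE_I2)
        fix p
        have "norm (F (X i) p - F t p) \<le> G p * norm (X i - t)"
        proof (rule differentiable_bound[where S = "{0..1}" and f' = "\<lambda>s h. h *\<^sub>R F' s p"])
          show "((\<lambda>s. F s p) has_derivative (\<lambda>h. h *\<^sub>R F' s p)) (at s within {0..1})" if "s \<in> {0..1}" for s
            using deriv[OF that] by (simp add: has_vector_derivative_def)
          show "onorm (\<lambda>h. h *\<^sub>R F' s p) \<le> G p" if "s \<in> {0..1}" for s
            using bound[OF that, of p] by (intro onorm_le) (auto simp: mult.commute[of "G p"] intro: mult_left_mono)
        qed (use X(1) t in auto)
        then show "norm ((1 / (X i - t)) *\<^sub>R (F (X i) p - F t p)) \<le> G p"
          using X(1) by (simp add: divide_simps mult.commute)
      qed
    qed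
qed

lemma integral_translate:
  fixes f :: "'a::euclidean_space \<Rightarrow> complex"
  assumes "integrable lborel f"
  shows "integrable lborel (\<lambda>p. f (p + c))" and "(\<integral>p. f (p + c) \<partial>lborel) = (\<integral>p. f p \<partial>lborel)"
proof -
  have [measurable]: "f \<in> borel_measurable borel"
    using borel_measurable_integrable[OF assms] by simp
  have 1: "integrable (distr lborel borel ((+) c)) f"
    using assms by (simp add: lborel_distr_plus)
  show "integrable lborel (\<lambda>p. f (p + c))"
    using integrable_distr[OF _ 1] by (simp add: add.commute)
  have "(\<integral>p. f p \<partial>lborel) = (\<integral>p. f p \<partial>distr lborel borel ((+) c))"
    by (simp add: lborel_distr_plus)
  also have "\<dots> = (\<integral>p. f (c + p) \<partial>lborel)"
    by (rule integral_distr) auto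
  finally show "(\<integral>p. f (p + c) \<partial>lborel) = (\<integral>p. f p \<partial>lborel)"
    by (simp add: add.commute)
qed

lemma
  fixes h q :: "'a::euclidean_space \<Rightarrow> complex"
  assumes h: "cpoly h" and c: "c > 0" "\<And>p. c * (norm p)\<^sup>2 \<le> Re (h p)" and q: "cpoly q"
  shows norm_exp_mult_cpoly_bound: "\<exists>K\<ge>0. \<forall>p. norm (exp (- h p) * q p) \<le> K * exp (- (c / 2) * (norm p)\<^sup>2)"
    and integrable_exp_mult_cpoly: "integrable lborel (\<lambda>p. exp (- h p) * q p)"
proof -
  obtain K where K: "K \<ge> 0" "\<And>p. exp (- c * (norm p)\<^sup>2) * norm (q p) \<le> K * exp (- (c / 2) * (norm p)\<^sup>2)"
    using gaussian_cpoly_bound[OF q c(1)] by auto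
  have b: "norm (exp (- h p) * q p) \<le> K * exp (- (c / 2) * (norm p)\<^sup>2)" for p
  proof -
    have "norm (exp (- h p) * q p) \<le> exp (- c * (norm p)\<^sup>2) * norm (q p)"
      using c(2)[of p] by (auto simp: norm_mult intro!: mult_right_mono)
    then show ?thesis using K(2)[of p] by linarith
  qed
  then show "\<exists>K\<ge>0. \<forall>p. norm (exp (- h p) * q p) \<le> K * exp (- (c / 2) * (norm p)\<^sup>2)"
    using K(1) by blast
  have "integrable lborel (\<lambda>p::'a. K * exp (- (c / 2) * (norm p)\<^sup>2))"
    using has_bochner_integral_gaussian[of "c / 2", where 'a = 'a] c(1)
    by (intro integrable_mult_right) (auto simp: has_bochner_integral_iff)
  then show "integrable lborel (\<lambda>p. exp (- h p) * q p)"
  proof (rule Bochner_Integration.integrable_bound)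
    have "continuous_on UNIV (\<lambda>p. exp (- h p) * q p)"
      using h q by (intro continuous_intros cpoly_continuous)
    then show "(\<lambda>p. exp (- h p) * q p) \<in> borel_measurable lborel"
      using borel_measurable_continuous_onI by simp
    show "AE p in lborel. norm (exp (- h p) * q p) \<le> norm (K * exp (- (c / 2) * (norm p)\<^sup>2))"
      using b K(1) by simp
  qed
qed

text \<open>
  The integral of \<open>f = e\<^bsup>-h\<^esup> q\<close> over translates by \<open>s e\<close> is constant in \<open>s\<close>. Differentiating it under the integral sign at
  \<open>s = 0\<close> shows that the directional derivative of \<open>f\<close> has integral zero.
\<close>

lemma integral_by_parts_exp_cpoly:
  fixes h q :: "'a::euclidean_space \<Rightarrow> complex"
  assumes h: "cpoly h" and c: "c > 0" "\<And>p. c * (norm p)\<^sup>2 \<le> Re (h p)" and q: "cpoly q"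
  shows "(\<integral>p. exp (- h p) * frechet_derivative q (at p) e \<partial>lborel) =
         (\<integral>p. exp (- h p) * (frechet_derivative h (at p) e * q p) \<partial>lborel)"
proof -
  define q' where "q' = (\<lambda>p. frechet_derivative q (at p) e - frechet_derivative h (at p) e * q p)"
  define f where "f = (\<lambda>p. exp (- h p) * q p)"
  define f' where "f' = (\<lambda>p. exp (- h p) * q' p)"
  have q': "cpoly q'"
    unfolding q'_def by (intro cpoly_diff cpoly_mult cpoly_frechet_derivative h q)
  note int = integrable_exp_mult_cpoly[OF h c]
  have f: "integrable lborel f" "integrable lborel f'"
    unfolding f_def f'_def by (intro int q q')+
  obtain K where K: "K \<ge> 0" "\<And>p. norm (f' p) \<le> K * exp (- (c / 2) * (norm p)\<^sup>2)"
    using norm_exp_mult_cpoly_bound[OF h c q'] unfolding f'_def by blast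
  \<comment> \<open>This dominates \<open>f'\<close> on all the translates with \<open>0 \<le> s \<le> 1\<close>, as \<open>|p|\<^sup>2 \<le> 2 |p + s e|\<^sup>2 + 2 |e|\<^sup>2\<close>.\<close>
  define G where "G = (\<lambda>p::'a. K * exp (c / 2 * (norm e)\<^sup>2) * exp (- (c / 4) * (norm p)\<^sup>2))"
  have "((\<lambda>s. \<integral>p. f (p + s *\<^sub>R e) \<partial>lborel) has_vector_derivative (\<integral>p. f' (p + 0 *\<^sub>R e) \<partial>lborel)) (at 0 within {0..1})"
  proof (rule has_vector_derivative_integral[where F = "\<lambda>s p. f (p + s *\<^sub>R e)" and F' = "\<lambda>s p. f' (p + s *\<^sub>R e)" and G = G])
    show "integrable lborel (\<lambda>p. f (p + s *\<^sub>R e))" for s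
      by (rule integral_translate(1)[OF f(1)])
    show "(\<lambda>p. f' (p + s *\<^sub>R e)) \<in> borel_measurable lborel" for s
      using integral_translate(1)[OF f(2)] by (rule borel_measurable_integrable)
    show "integrable lborel G"
      unfolding G_def using has_bochner_integral_gaussian[of "c / 4", where 'a = 'a] c(1)
      by (intro integrable_mult_right) (auto simp: has_bochner_integral_iff)
    show "norm (f' (p + s *\<^sub>R e)) \<le> G p" if s: "s \<in> {0..1}" for s p
    proof -
      have "norm p \<le> norm (p + s *\<^sub>R e) + norm e"
      proof -
        have "norm p \<le> norm (p + s *\<^sub>R e) + norm (s *\<^sub>R e)"
          using norm_triangle_ineq4[of "p + s *\<^sub>R e" "s *\<^sub>R e"] by simp
        also have "norm (s *\<^sub>R e) \<le> norm e"
          using s by (simp add: mult_left_le_one_le)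
        finally show ?thesis by simp
      qed
      then have "(norm p)\<^sup>2 \<le> (norm (p + s *\<^sub>R e) + norm e)\<^sup>2"
        by (intro power_mono) auto
      also have "\<dots> \<le> 2 * (norm (p + s *\<^sub>R e))\<^sup>2 + 2 * (norm e)\<^sup>2"
        using zero_le_power2[of "norm (p + s *\<^sub>R e) - norm e"] by (simp add: power2_sum power2_diff)
      finally have "c / 4 * (norm p)\<^sup>2 \<le> c / 4 * (2 * (norm (p + s *\<^sub>R e))\<^sup>2 + 2 * (norm e)\<^sup>2)"
        using c(1) by (intro mult_left_mono) auto
      then have "- (c / 2) * (norm (p + s *\<^sub>R e))\<^sup>2 \<le> c / 2 * (norm e)\<^sup>2 + - (c / 4) * (norm p)\<^sup>2"
        by (simp add: algebra_simps)
      then have "exp (- (c / 2) * (norm (p + s *\<^sub>R e))\<^sup>2) \<le> exp (c / 2 * (norm e)\<^sup>2) * exp (- (c / 4) * (norm p)\<^sup>2)"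
        by (simp flip: exp_add)
      then have "K * exp (- (c / 2) * (norm (p + s *\<^sub>R e))\<^sup>2) \<le> G p"
        using K(1) unfolding G_def mult.assoc by (intro mult_left_mono)
      then show ?thesis using K(2)[of "p + s *\<^sub>R e"] by linarith
    qed
    show "((\<lambda>s. f (p + s *\<^sub>R e)) has_vector_derivative f' (p + s *\<^sub>R e)) (at s within {0..1})" for s p
    proof -
      have "(f has_derivative (\<lambda>v. exp (- h (p + s *\<^sub>R e)) * frechet_derivative q (at (p + s *\<^sub>R e)) v +
          exp (- h (p + s *\<^sub>R e)) * (- frechet_derivative h (at (p + s *\<^sub>R e)) v) * q (p + s *\<^sub>R e))) (at (p + s *\<^sub>R e))"
      proof -
        have "((\<lambda>x. - h x) has_derivative (\<lambda>v. - frechet_derivative h (at (p + s *\<^sub>R e)) v)) (at (p + s *\<^sub>R e))"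
          using h by (intro has_derivative_minus cpoly_has_frechet_derivative)
        moreover have "(exp has_derivative (*) (exp (- h (p + s *\<^sub>R e)))) (at (- h (p + s *\<^sub>R e)))"
          using DERIV_exp unfolding has_field_derivative_def by blast
        ultimately have "((\<lambda>x. exp (- h x)) has_derivative
            (\<lambda>v. exp (- h (p + s *\<^sub>R e)) * (- frechet_derivative h (at (p + s *\<^sub>R e)) v))) (at (p + s *\<^sub>R e))"
          by (rule has_derivative_compose)
        then show ?thesis
          unfolding f_def by (rule has_derivative_mult) (rule cpoly_has_frechet_derivative[OF q])
      qed
      moreover have "((\<lambda>s. p + s *\<^sub>R e) has_vector_derivative e) (at s within {0..1})"
        by (auto intro!: derivative_eq_intros)
      ultimately have "(f \<circ> (\<lambda>s. p + s *\<^sub>R e) has_vector_derivative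
          exp (- h (p + s *\<^sub>R e)) * frechet_derivative q (at (p + s *\<^sub>R e)) e +
          exp (- h (p + s *\<^sub>R e)) * (- frechet_derivative h (at (p + s *\<^sub>R e)) e) * q (p + s *\<^sub>R e)) (at s within {0..1})"
        by (intro vector_derivative_diff_chain_within) (auto intro: has_derivative_at_withinI)
      then show ?thesis
        by (simp add: f'_def q'_def o_def algebra_simps)
    qed
  qed auto
  then have "((\<lambda>s::real. \<integral>p. f p \<partial>lborel) has_vector_derivative (\<integral>p. f' p \<partial>lborel)) (at 0 within {0..1})"
    by (simp add: integral_translate(2)[OF f(1)])
  moreover have "((\<lambda>s::real. \<integral>p. f p \<partial>lborel) has_vector_derivative 0) (at 0 within {0..1})"
    by (rule has_vector_derivative_const)
  moreover have "at (0::real) within {0..1} \<noteq> bot"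
    by (simp add: trivial_limit_within islimpt_Icc)
  ultimately have "(\<integral>p. f' p \<partial>lborel) = 0"
    using vector_derivative_unique_within by blast
  then show ?thesis
    unfolding f'_def q'_def right_diff_distrib
    using h q by (subst (asm) Bochner_Integration.integral_diff)
      (auto intro!: int cpoly_frechet_derivative cpoly_mult)
qed

section \<open>The fermionic derivative\<close>

text \<open>
  The derivative with respect to \<open>\<psi>\<^sub>z\<close>. Since \<open>\<psi>\<^sub>z\<close> and \<open>\<psi>*\<^sub>z\<close> are \<open>(2 \<pi> \<i>)\<^bsup>-1/2\<^esup> (du \<plusminus> \<i> dv)\<close>, it is
  \<open>(2 \<pi> \<i>)\<^bsup>1/2\<^esup> (\<iota>\<^sub>u - \<i> \<iota>\<^sub>v) / 2\<close>, where \<open>\<iota>\<close> is the contraction along a coordinate.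
\<close>

definition psi_derivative :: "'n \<Rightarrow> 'n::{finite,linorder} form \<Rightarrow> 'n form" where
  "psi_derivative z \<omega> = const_form (csqrt (2 * of_real pi * \<i>) / 2) *
     (contract (Cu z) \<omega> - const_form \<i> * contract (Cv z) \<omega>)"

lemma psi_derivative_mult:
  "psi_derivative z (\<omega> * \<eta>) = psi_derivative z \<omega> * \<eta> + grade_inv \<omega> * psi_derivative z \<eta>"
  unfolding psi_derivative_def contract_mult
  by (simp add: algebra_simps fun_form_left_commute[of "grade_inv \<omega>"])

lemma psi_derivative_even_mult:
  "grade_inv \<omega> = \<omega> \<Longrightarrow> psi_derivative z (\<omega> * \<eta>) = psi_derivative z \<omega> * \<eta> + \<omega> * psi_derivative z \<eta>"
  by (simp add: psi_derivative_mult)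

lemma psi_derivative_add [simp]: "psi_derivative z (\<omega> + \<eta>) = psi_derivative z \<omega> + psi_derivative z \<eta>"
  by (simp add: psi_derivative_def algebra_simps)

lemma psi_derivative_fun_form [simp]: "psi_derivative z (fun_form f) = 0"
  by (simp add: psi_derivative_def)

lemma psi_derivative_one [simp]: "psi_derivative z 1 = 0"
  by (simp add: one_form_eq)

lemma psi_derivative_fun_form_mult [simp]:
  "psi_derivative z (fun_form f * \<omega>) = fun_form f * psi_derivative z \<omega>"
  by (simp add: psi_derivative_mult)

lemma psi_derivative_sum [simp]:
  "psi_derivative z (\<Sum>i\<in>I. \<omega> i) = (\<Sum>i\<in>I. psi_derivative z (\<omega> i))"
proof (induction I rule: infinite_finite_induct)
  case (infinite A)
  then show ?case by (simp add: psi_derivative_def form_eqI form_coeff_contract)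
next
  case empty
  show ?case by (rule form_eqI) (simp add: psi_derivative_def form_coeff_contract)
qed simp

lemma psi_derivative_psi [simp]: "psi_derivative z (psi x) = (if x = z then 1 else 0)"
  by (rule form_eqI)
     (auto simp: psi_derivative_def psi_def dphi_def form_coeff_one)

lemma psi_derivative_psi_bar [simp]: "psi_derivative z (psi_bar x) = 0"
  by (rule form_eqI)
     (auto simp: psi_derivative_def psi_bar_def dphi_bar_def form_coeff_one)

lemma form_coeff_psi_derivative_UNIV [simp]: "form_coeff (psi_derivative z \<omega>) p UNIV = 0"
  by (simp add: psi_derivative_def form_coeff_contract)

lemma odd_anticommute_add_const_mult:
  fixes \<alpha> \<alpha>' \<beta> :: "'n::{finite,linorder} form"
  assumes "\<alpha> * \<beta> = - (\<beta> * \<alpha>)" "\<alpha>' * \<beta> = - (\<beta> * \<alpha>')"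
  shows "(\<alpha> + const_form c * \<alpha>') * \<beta> = - (\<beta> * (\<alpha> + const_form c * \<alpha>'))"
  using assms by (simp add: distrib_left distrib_right mult.assoc fun_form_left_commute[of \<beta>])

lemma psi_psi_bar_anticommute: "psi x * psi_bar y = - (psi_bar y * psi x)"
proof -
  have 1: "dphi x * coord_diff c = - (coord_diff c * dphi x)" for c
    unfolding dphi_def by (intro odd_anticommute_add_const_mult coord_diff_anticommute)
  have bar: "dphi_bar y = coord_diff (Cu y) + const_form (- \<i>) * coord_diff (Cv y)"
    by (rule form_eqI) (simp add: dphi_bar_def)
  have "dphi_bar y * dphi x = - (dphi x * dphi_bar y)"
    unfolding bar by (intro odd_anticommute_add_const_mult) (simp_all add: 1)
  then show ?thesis
    by (simp add: psi_def psi_bar_def mult.assoc fun_form_left_commute[of "dphi _"] fun_form_left_commute[of "dphi_bar _"])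
qed

section \<open>The fermionic exponential\<close>

text \<open>
  The fermionic factor of \<open>e\<^bsup>-S\<^esup>\<close>; its coefficients do not depend on the point.
\<close>

definition fermi_exp :: "complex^'n::{finite,linorder}^'n::{finite,linorder} \<Rightarrow> 'n form" where
  "fermi_exp A = (\<Sum>n = 0..CARD('n). const_form ((-1) ^ n / fact n) * psi_quad A ^ n)"

lemma exp_neg_S_eq: "exp_neg_S A = fun_form (\<lambda>p. exp (- phi_quad A p)) * fermi_exp A"
  by (simp add: exp_neg_S_def fermi_exp_def)

lemma grade_inv_psi_quad [simp]: "grade_inv (psi_quad A) = psi_quad A"
  by (simp add: psi_quad_def grade_inv_mult)

lemma grade_inv_fermi_exp [simp]: "grade_inv (fermi_exp A) = fermi_exp A"
  by (simp add: fermi_exp_def grade_inv_mult grade_inv_power)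

text \<open>
  Used to see that \<open>\<psi>A\<psi>*\<close> is nilpotent: its powers vanish once their degree exceeds \<open>2 M\<close>.
\<close>

definition min_degree :: "nat \<Rightarrow> 'n::finite form \<Rightarrow> bool" where
  "min_degree k \<omega> \<longleftrightarrow> (\<forall>p S. card S < k \<longrightarrow> form_coeff \<omega> p S = 0)"

lemma min_degreeD: "min_degree k \<omega> \<Longrightarrow> card S < k \<Longrightarrow> form_coeff \<omega> p S = 0"
  unfolding min_degree_def by blast

lemma min_degree_mult:
  fixes \<omega> \<eta> :: "'n::{finite,linorder} form"
  assumes "min_degree k \<omega>" "min_degree l \<eta>"
  shows "min_degree (k + l) (\<omega> * \<eta>)"
  unfolding min_degree_def form_coeff_mult
proof (intro allI impI sum.neutral ballI)
  fix p and S T :: "'n coord set"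
  assume *: "card S < k + l" "T \<in> Pow S"
  then have "card S = card T + card (S - T)"
    using card_Un_disjoint[of T "S - T"] by (simp add: Un_absorb1)
  then have "card T < k \<or> card (S - T) < l" using * by linarith
  then show "wedge_sign T (S - T) * form_coeff \<omega> p T * form_coeff \<eta> p (S - T) = 0"
    by (auto simp: min_degreeD[OF assms(1)] min_degreeD[OF assms(2)])
qed

lemma min_degree_psi_quad: "min_degree 2 (psi_quad (A :: complex^'n::{finite,linorder}^'n::{finite,linorder}))"
proof -
  have c: "min_degree 1 (coord_diff c)" for c :: "'n coord"
    by (auto simp: min_degree_def coord_diff_def)
  have "min_degree 1 (psi x)" "min_degree 1 (psi_bar x)" for x :: 'n
    using c by (auto simp: min_degree_def psi_def psi_bar_def dphi_def dphi_bar_def)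
  then have "min_degree (1 + 1) (psi x * psi_bar y)" for x y :: 'n
    by (intro min_degree_mult)
  then show ?thesis
    by (auto simp: min_degree_def psi_quad_def mult.assoc)
qed

lemma min_degree_power:
  fixes \<omega> :: "'n::{finite,linorder} form"
  assumes "min_degree k \<omega>"
  shows "min_degree (k * n) (\<omega> ^ n)"
proof (induction n)
  case 0
  show ?case by (simp add: min_degree_def)
next
  case (Suc n)
  then show ?case using min_degree_mult[OF assms Suc.IH] by simp
qed

lemma card_coord: "CARD('n::finite coord) = 2 * CARD('n)"
proof -
  have "(UNIV :: 'n coord set) = range Cu \<union> range Cv"
    by (metis UNIV_eq_I UnI1 UnI2 coord.exhaust rangeI)
  moreover have "card (range Cu \<union> range Cv :: 'n coord set) = card (range (Cu :: 'n \<Rightarrow> _)) + card (range (Cv :: 'n \<Rightarrow> _))"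
    by (intro card_Un_disjoint) auto
  ultimately show ?thesis
    by (simp add: card_image inj_def)
qed

lemma psi_quad_mult_power_zero: "psi_quad B * psi_quad A ^ CARD('n) = (0 :: 'n::{finite,linorder} form)"
proof (rule form_eqI)
  fix p and S :: "'n coord set"
  have "min_degree (2 + 2 * CARD('n)) (psi_quad B * psi_quad A ^ CARD('n) :: 'n form)"
    by (intro min_degree_mult min_degree_power min_degree_psi_quad)
  moreover have "card S < 2 + 2 * CARD('n)"
    using card_mono[of UNIV S] by (simp add: card_coord)
  ultimately show "form_coeff (psi_quad B * psi_quad A ^ CARD('n)) p S = form_coeff 0 p S"
    unfolding form_coeff_zero by (rule min_degreeD)
qed

text \<open>
  A derivation with \<open>d N\<^sup>n = n \<eta> N\<^bsup>n - 1\<^esup>\<close> satisfies \<open>d e\<^bsup>-N\<^esup> = - \<eta> e\<^bsup>-N\<^esup>\<close>. For the series cut off after \<open>N\<^sup>M\<close> this is exact if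
  \<open>\<eta> N\<^sup>M = 0\<close>. Only the values \<open>d n\<close> of the derivation on the powers \<open>N\<^sup>n\<close> enter, so that the lemma covers contractions as well
  as differentiation with respect to a parameter.
\<close>

lemma truncated_exp_derivative:
  fixes N \<eta> :: "'n::{finite,linorder} form"
  assumes d0: "d 0 = 0" and dSuc: "\<And>n. d (Suc n) = const_form (of_nat (Suc n)) * (\<eta> * N ^ n)"
    and top: "\<eta> * N ^ M = 0"
  shows "(\<Sum>n = 0..M. const_form ((-1) ^ n / fact n) * d n) =
    - (\<eta> * (\<Sum>n = 0..M. const_form ((-1) ^ n / fact n) * N ^ n))"
proof -
  have "(\<Sum>n = 0..m. const_form ((-1) ^ n / fact n) * d n) =
    - (\<eta> * (\<Sum>n<m. const_form ((-1) ^ n / fact n) * N ^ n))" for m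
  proof (induction m)
    case (Suc m)
    have "const_form ((-1) ^ Suc m / fact (Suc m)) * d (Suc m) = - (\<eta> * (const_form ((-1) ^ m / fact m) * N ^ m))"
    proof -
      have *: "const_form a * (const_form k * \<omega>) = - (const_form b * \<omega>)" if "a * k = - b" for a b k and \<omega> :: "'n form"
        unfolding fun_form_mult_assoc that by (rule form_eqI) simp
      have "(-1) ^ Suc m / fact (Suc m) * of_nat (Suc m) = - ((-1) ^ m / fact m :: complex)"
        by (simp add: field_simps del: of_nat_Suc)
      then show ?thesis
        unfolding dSuc fun_form_left_commute[of \<eta>] by (rule *)
    qed
    then show ?case using Suc by (simp add: distrib_left)
  qed (simp add: d0)
  moreover have "\<eta> * (\<Sum>n = 0..M. const_form ((-1) ^ n / fact n) * N ^ n) =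
      \<eta> * (\<Sum>n<M. const_form ((-1) ^ n / fact n) * N ^ n)"
    by (simp add: atLeast0AtMost lessThan_Suc_atMost[symmetric] distrib_left fun_form_left_commute[of \<eta>] top)
  ultimately show ?thesis by simp
qed

text \<open>
  Here \<open>d n\<close> stands for the derivative of \<open>N\<^sup>n\<close>; the second hypothesis on it is the Leibniz rule for \<open>N \<cdot> N\<^sup>n\<close>.
\<close>

lemma even_power_derivative:
  fixes N \<eta> :: "'n::{finite,linorder} form"
  assumes N: "grade_inv N = N" and d1: "d (1::nat) = \<eta>"
    and d: "\<And>n. d (Suc n) = \<eta> * N ^ n + N * d n"
  shows "d (Suc n) = const_form (of_nat (Suc n)) * (\<eta> * N ^ n)"
proof (induction n)
  case 0
  show ?case using d1 by (simp flip: one_form_eq)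
next
  case (Suc n)
  have "d (Suc (Suc n)) = \<eta> * N ^ Suc n + const_form (of_nat (Suc n)) * (N * \<eta> * N ^ n)"
    unfolding d[of "Suc n"] Suc by (simp add: fun_form_left_commute[of N] mult.assoc)
  also have "N * \<eta> * N ^ n = \<eta> * N ^ Suc n"
    by (simp add: even_form_commute[OF N] mult.assoc)
  finally show ?case
    by (intro form_eqI) (simp add: algebra_simps)
qed

lemma contract_fermi_exp:
  fixes A :: "complex^'n::{finite,linorder}^'n::{finite,linorder}"
  shows
  "contract c (fermi_exp A) = - (contract c (psi_quad A) * fermi_exp A)"
proof -
  let ?N = "psi_quad A"
  have d: "contract c (?N ^ Suc n) = const_form (of_nat (Suc n)) * (contract c ?N * ?N ^ n)" for n
    by (rule even_power_derivative[where d = "\<lambda>n. contract c (?N ^ n)"]) (simp_all add: contract_mult)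
  \<comment> \<open>Contracting \<open>N\<^bsup>M + 1\<^esup> = 0\<close> shows that the boundary term of the truncated series vanishes.\<close>
  have "const_form (of_nat (Suc CARD('n))) * (contract c ?N * ?N ^ CARD('n)) = 0"
    unfolding d[symmetric] power_Suc psi_quad_mult_power_zero
    by (rule form_eqI) (simp add: form_coeff_contract)
  then have "const_form (1 / of_nat (Suc CARD('n))) * (const_form (of_nat (Suc CARD('n))) * (contract c ?N * ?N ^ CARD('n))) = 0"
    by simp
  then have top: "contract c ?N * ?N ^ CARD('n) = 0"
    by (simp add: fun_form_mult_assoc del: of_nat_Suc flip: one_form_eq)
  show ?thesis
    unfolding fermi_exp_def contract_sum contract_fun_form_mult
    by (rule truncated_exp_derivative[OF _ d top]) (simp add: one_form_eq)
qed

lemma psi_derivative_psi_quad: "psi_derivative z (psi_quad A) = (\<Sum>y\<in>UNIV. const_form (A $ z $ y) * psi_bar y)"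
proof -
  have "psi_derivative z (psi_quad A) = (\<Sum>x\<in>UNIV. \<Sum>y\<in>UNIV. if x = z then const_form (A $ z $ y) * psi_bar y else 0)"
    unfolding psi_quad_def psi_derivative_sum
    by (intro sum.cong) (auto simp: mult.assoc psi_derivative_mult[of _ "psi _"])
  then show ?thesis by (subst (asm) sum.swap) simp
qed

lemma psi_derivative_fermi_exp:
  "psi_derivative z (fermi_exp A) = - (\<Sum>y\<in>UNIV. const_form (A $ z $ y) * (psi_bar y * fermi_exp A))"
proof -
  have "psi_derivative z (fermi_exp A) = - (psi_derivative z (psi_quad A) * fermi_exp A)"
    unfolding psi_derivative_def contract_fermi_exp
    by (simp add: algebra_simps)
  then show ?thesis
    by (simp add: psi_derivative_psi_quad sum_distrib_right mult.assoc)
qed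

lemma form_coeff_empty_fermi_exp:
  fixes A :: "complex^'n::{finite,linorder}^'n::{finite,linorder}"
  shows "form_coeff (fermi_exp A) p {} = 1"
proof -
  have 0: "form_coeff (psi_quad A ^ n) p {} = 0" if "n > 0" for n
    by (rule min_degreeD[OF min_degree_power[OF min_degree_psi_quad]]) (use that in simp)
  have "form_coeff (fermi_exp A) p {} = (\<Sum>n = 0..CARD('n). if n = 0 then 1 else 0 :: complex)"
    unfolding fermi_exp_def form_coeff_sum by (rule sum.cong) (auto simp: 0 form_coeff_one)
  then show ?thesis by simp
qed

lemma psi_quad_one:
  "psi_quad (mat 1) = - (\<Sum>x\<in>UNIV. const_form (1 / of_real pi) * (coord_diff (Cu x) * coord_diff (Cv x)))"
proof -
  have "psi_quad (mat 1 :: complex^'n::{finite,linorder}^'n::{finite,linorder}) = (\<Sum>x\<in>UNIV. \<Sum>y\<in>UNIV. if y = x then psi x * psi_bar x else 0)"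
    unfolding psi_quad_def by (intro sum.cong) (auto simp: mat_def form_eqI mult.assoc)
  then show ?thesis
    by (simp add: psi_psi_bar_anticommute psi_bar_mult_psi sum_negf)
qed

text \<open>
  For the identity matrix \<open>- \<psi>\<psi>* = \<Sum>\<^sub>x du\<^sub>x dv\<^sub>x / \<pi>\<close>. Contracting its exponential along \<open>u\<^sub>x\<close> and \<open>v\<^sub>x\<close> gives back
  \<open>1 / \<pi>\<close> times the exponential, up to a multiple of \<open>dv\<^sub>x\<close>. The reordering signs cancel, because \<open>u\<^sub>x\<close> and \<open>v\<^sub>x\<close> are
  adjacent in the order of the coordinates.
\<close>

lemma form_coeff_fermi_exp_one_step:
  fixes x :: "'n::{finite,linorder}"
  assumes S: "Cu x \<notin> S" "Cv x \<notin> S"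
  shows "form_coeff (fermi_exp (mat 1)) p (insert (Cu x) (insert (Cv x) S)) =
    1 / of_real pi * form_coeff (fermi_exp (mat 1)) p S"
proof -
  let ?E = "fermi_exp (mat 1 :: complex^'n::{finite,linorder}^'n::{finite,linorder})" and ?v = "coord_diff (Cv x)"
  have "contract (Cu x) (psi_quad (mat 1)) = - (const_form (1 / of_real pi) * ?v)"
    by (simp add: psi_quad_one contract_mult if_distrib[of "\<lambda>a. a * _"] if_distrib[of "\<lambda>a. _ * a"] cong: if_cong)
  then have "contract (Cu x) ?E = const_form (1 / of_real pi) * (?v * ?E)"
    by (simp add: contract_fermi_exp mult.assoc)
  then have *: "contract (Cv x) (contract (Cu x) ?E) = const_form (1 / of_real pi) * (?E - ?v * contract (Cv x) ?E)"
    by (simp add: contract_mult[of _ ?v])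
  have "form_coeff (?v * \<omega>) p S = 0" for \<omega>
    unfolding form_coeff_mult using S(2) by (intro sum.neutral) (auto simp: coord_diff_def)
  with * have 1: "form_coeff (contract (Cv x) (contract (Cu x) ?E)) p S = 1 / of_real pi * form_coeff ?E p S"
    by simp
  have "wedge_sign {Cu x} S = wedge_sign {Cv x} S"
  proof -
    have "bij_betw (\<lambda>(s, t). (Cv x, t)) {(s, t). s \<in> {Cu x} \<and> t \<in> S \<and> precedes t s} {(s, t). s \<in> {Cv x} \<and> t \<in> S \<and> precedes t s}"
    proof -
      have "precedes t (Cu x) \<longleftrightarrow> precedes t (Cv x)" if "t \<in> S" for t
        using that S(1,2) by (cases t) (auto simp: order.order_iff_strict)
      then show ?thesis by (intro bij_betwI[where g = "\<lambda>(s, t). (Cu x, t)"]) auto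
    qed
    then show ?thesis by (simp add: wedge_sign_def bij_betw_same_card)
  qed
  moreover have "wedge_sign {Cu x} (insert (Cv x) S) = wedge_sign {Cu x} S"
    using wedge_sign_Un_right[of "{Cv x}" S "{Cu x}"] S(2) by (simp add: wedge_sign_singletons)
  ultimately have "form_coeff (contract (Cv x) (contract (Cu x) ?E)) p S =
      (wedge_sign {Cv x} S * wedge_sign {Cv x} S) * form_coeff ?E p (insert (Cu x) (insert (Cv x) S))"
    using S(1,2) by (simp add: form_coeff_contract)
  then show ?thesis using 1 by (simp add: wedge_sign_square)
qed

lemma form_coeff_UNIV_fermi_exp_one:
  "form_coeff (fermi_exp (mat 1 :: complex^'n::{finite,linorder}^'n::{finite,linorder})) p UNIV = (1 / of_real pi) ^ CARD('n)"
proof -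
  have "form_coeff (fermi_exp (mat 1)) p (Cu ` X \<union> Cv ` X) = (1 / of_real pi) ^ card X" for X :: "'n set"
  proof (induction X rule: infinite_finite_induct)
    case (insert x X)
    have "Cu ` insert x X \<union> Cv ` insert x X = insert (Cu x) (insert (Cv x) (Cu ` X \<union> Cv ` X))"
      by auto
    then show ?case
      using insert form_coeff_fermi_exp_one_step[of x "Cu ` X \<union> Cv ` X" p] by auto
  qed (simp_all add: form_coeff_empty_fermi_exp)
  moreover have "range Cu \<union> range Cv = (UNIV :: 'n coord set)"
    by (metis UNIV_eq_I UnI1 UnI2 coord.exhaust rangeI)
  ultimately show ?thesis by metis
qed

section \<open>Polynomial forms and the bosonic derivative\<close>

text \<open>
  The derivative with respect to \<open>\<phi>\<^sub>z = u\<^sub>z + \<i> v\<^sub>z\<close>, namely \<open>(\<partial>/\<partial>u\<^sub>z - \<i> \<partial>/\<partial>v\<^sub>z) / 2\<close>.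
\<close>

definition wirtinger :: "'n \<Rightarrow> ((real^'n) \<times> (real^'n) \<Rightarrow> complex) \<Rightarrow> (real^'n) \<times> (real^'n) \<Rightarrow> complex" where
  "wirtinger z f p = (frechet_derivative f (at p) (axis z 1, 0) - \<i> * frechet_derivative f (at p) (0, axis z 1)) / 2"

lemma wirtinger_eqI:
  assumes "(f has_derivative f') (at p)"
  shows "wirtinger z f p = (f' (axis z 1, 0) - \<i> * f' (0, axis z 1)) / 2"
  using frechet_derivative_at[OF assms] by (simp add: wirtinger_def)

lemma wirtinger_const [simp]: "wirtinger z (\<lambda>p. c) p = 0"
  by (simp add: wirtinger_eqI[OF has_derivative_const])

lemma wirtinger_add:
  "cpoly f \<Longrightarrow> cpoly g \<Longrightarrow> wirtinger z (\<lambda>p. f p + g p) p = wirtinger z f p + wirtinger z g p"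
  by (subst wirtinger_eqI[OF has_derivative_add[OF cpoly_has_frechet_derivative cpoly_has_frechet_derivative]])
     (simp_all add: wirtinger_def field_simps)

lemma wirtinger_mult:
  "cpoly f \<Longrightarrow> cpoly g \<Longrightarrow> wirtinger z (\<lambda>p. f p * g p) p = wirtinger z f p * g p + f p * wirtinger z g p"
  by (subst wirtinger_eqI[OF has_derivative_mult[OF cpoly_has_frechet_derivative cpoly_has_frechet_derivative]])
     (simp_all add: wirtinger_def field_simps)

lemma wirtinger_sum:
  "(\<And>i. i \<in> I \<Longrightarrow> cpoly (f i)) \<Longrightarrow> wirtinger z (\<lambda>p. \<Sum>i\<in>I. f i p) p = (\<Sum>i\<in>I. wirtinger z (f i) p)"
  by (induction I rule: infinite_finite_induct) (simp_all add: wirtinger_add cpoly_sum)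

lemma bounded_linear_phi: "bounded_linear (phi x)" "bounded_linear (phi_bar x)"
  unfolding linear_conv_bounded_linear[symmetric]
  by (rule linearI; simp add: phi_def phi_bar_def split_beta algebra_simps scaleR_conv_of_real[where 'a = complex])+

lemma cpoly_phi [simp, intro]: "cpoly (phi x)" "cpoly (phi_bar x)"
  by (auto intro: cpoly_linear bounded_linear_phi)

lemma wirtinger_phi [simp]:
  "wirtinger z (phi x) p = (if x = z then 1 else 0)"
  "wirtinger z (phi_bar x) p = 0"
proof -
  have eq: "wirtinger z f p = (f (axis z 1, 0) - \<i> * f (0, axis z 1)) / 2" if "bounded_linear f" for f
    by (rule wirtinger_eqI[OF bounded_linear_imp_has_derivative[OF that]])
  show "wirtinger z (phi x) p = (if x = z then 1 else 0)" "wirtinger z (phi_bar x) p = 0"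
    unfolding eq[OF bounded_linear_phi(1)] eq[OF bounded_linear_phi(2)]
    by (simp_all add: phi_def phi_bar_def axis_def)
qed

lemma cpoly_phi_quad: "cpoly (phi_quad A)"
proof -
  have "cpoly (\<lambda>p. phi_quad A p)"
    unfolding phi_quad_def by (intro cpoly_sum cpoly_mult cpoly_phi cpoly_const)
  then show ?thesis by simp
qed

lemma wirtinger_phi_quad: "wirtinger z (phi_quad A) p = (\<Sum>y\<in>UNIV. A $ z $ y * phi_bar y p)"
proof -
  have c: "cpoly (\<lambda>p. phi x p * A $ x $ y)" for x y
    by (intro cpoly_mult cpoly_phi cpoly_const)
  have "wirtinger z (\<lambda>p. phi_quad A p) p = (\<Sum>x\<in>UNIV. \<Sum>y\<in>UNIV. if x = z then A $ z $ y * phi_bar y p else 0)"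
    unfolding phi_quad_def
    by (simp add: wirtinger_sum cpoly_sum cpoly_mult c wirtinger_mult cpoly_const cong: if_cong)
       (intro sum.cong refl, auto)
  then show ?thesis by (subst (asm) sum.swap) simp
qed

definition poly_form :: "'n::finite form \<Rightarrow> bool" where
  "poly_form \<omega> \<longleftrightarrow> (\<forall>S. cpoly (\<lambda>p. form_coeff \<omega> p S))"

definition phi_derivative :: "'n \<Rightarrow> 'n::finite form \<Rightarrow> 'n form" where
  "phi_derivative z \<omega> = Form (\<lambda>p S. wirtinger z (\<lambda>p. form_coeff \<omega> p S) p)"

lemma form_coeff_phi_derivative [simp]:
  "form_coeff (phi_derivative z \<omega>) p S = wirtinger z (\<lambda>p. form_coeff \<omega> p S) p"
  by (simp add: phi_derivative_def)

lemma poly_formD: "poly_form \<omega> \<Longrightarrow> cpoly (\<lambda>p. form_coeff \<omega> p S)"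
  by (simp add: poly_form_def)

lemma poly_form_add: "poly_form \<omega> \<Longrightarrow> poly_form \<eta> \<Longrightarrow> poly_form (\<omega> + \<eta> :: 'n::{finite,linorder} form)"
  by (simp add: poly_form_def cpoly_add)

lemma poly_form_diff: "poly_form \<omega> \<Longrightarrow> poly_form \<eta> \<Longrightarrow> poly_form (\<omega> - \<eta> :: 'n::{finite,linorder} form)"
  by (simp add: poly_form_def cpoly_diff)

lemma poly_form_sum:
  "(\<And>i. i \<in> I \<Longrightarrow> poly_form (\<omega> i)) \<Longrightarrow> poly_form (\<Sum>i\<in>I. \<omega> i :: 'n::{finite,linorder} form)"
  by (simp add: poly_form_def cpoly_sum)

lemma poly_form_mult: "poly_form \<omega> \<Longrightarrow> poly_form \<eta> \<Longrightarrow> poly_form (\<omega> * \<eta> :: 'n::{finite,linorder} form)"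
  unfolding poly_form_def form_coeff_mult by (auto intro!: cpoly_sum cpoly_mult cpoly_const)

lemma poly_form_fun_form: "cpoly f \<Longrightarrow> poly_form (fun_form f)"
  proof -
  assume "cpoly f"
  then have "cpoly (\<lambda>p. if S = {} then f p else 0)" for S :: "'a coord set"
    by (cases "S = {}") (auto intro: cpoly_const)
  then show ?thesis by (simp add: poly_form_def form_coeff_fun_form)
qed

lemma poly_form_one: "poly_form (1 :: 'n::{finite,linorder} form)"
  by (auto simp: poly_form_def form_coeff_one intro: cpoly_const)

lemma poly_form_coord_diff: "poly_form (coord_diff c)"
  by (auto simp: poly_form_def coord_diff_def intro: cpoly_const)

lemma poly_form_psi: "poly_form (psi x)" "poly_form (psi_bar x)"
  unfolding psi_def psi_bar_def dphi_def dphi_bar_def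
  by (intro poly_form_mult poly_form_add poly_form_diff poly_form_coord_diff poly_form_fun_form cpoly_const)+

lemmas poly_form_intros = poly_form_add poly_form_sum poly_form_mult poly_form_fun_form poly_form_one poly_form_psi

lemma poly_form_power: "poly_form \<omega> \<Longrightarrow> poly_form (\<omega> ^ n :: 'n::{finite,linorder} form)"
  by (induction n) (simp_all add: poly_form_one poly_form_mult)

lemma poly_form_psi_quad: "poly_form (psi_quad A)"
  unfolding psi_quad_def by (intro poly_form_intros cpoly_const)

lemma poly_form_fermi_exp: "poly_form (fermi_exp A)"
  unfolding fermi_exp_def by (intro poly_form_intros poly_form_power poly_form_psi_quad cpoly_const)

lemma phi_derivative_add:
  "poly_form \<omega> \<Longrightarrow> poly_form \<eta> \<Longrightarrow>
    phi_derivative z (\<omega> + \<eta>) = phi_derivative z \<omega> + phi_derivative z (\<eta> :: 'n::{finite,linorder} form)"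
  by (rule form_eqI) (simp add: poly_form_def wirtinger_add)

lemma phi_derivative_mult:
  fixes \<omega> \<eta> :: "'n::{finite,linorder} form"
  assumes "poly_form \<omega>" "poly_form \<eta>"
  shows "phi_derivative z (\<omega> * \<eta>) = phi_derivative z \<omega> * \<eta> + \<omega> * phi_derivative z \<eta>"
proof (rule form_eqI)
  fix p and S :: "'n coord set"
  note c = poly_formD[OF assms(1)] poly_formD[OF assms(2)]
  have 1: "cpoly (\<lambda>p. wedge_sign T (S - T) * form_coeff \<omega> p T)" for T
    by (intro cpoly_mult cpoly_const c)
  show "form_coeff (phi_derivative z (\<omega> * \<eta>)) p S = form_coeff (phi_derivative z \<omega> * \<eta> + \<omega> * phi_derivative z \<eta>) p S"
    by (simp add: form_coeff_mult wirtinger_sum cpoly_mult[OF 1] c(2) wirtinger_mult[OF 1] wirtinger_mult[OF cpoly_const c(1)]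
        sum.distrib)
qed

lemma phi_derivative_fun_form: "phi_derivative z (fun_form f) = fun_form (wirtinger z f)"
  by (rule form_eqI) (simp add: form_coeff_fun_form if_distrib[of "\<lambda>f. wirtinger z f _"])

definition constant_form :: "'n::finite form \<Rightarrow> bool" where
  "constant_form \<omega> \<longleftrightarrow> (\<forall>S. \<exists>c. (\<lambda>p. form_coeff \<omega> p S) = (\<lambda>p. c))"

lemma constant_form_iff: "constant_form \<omega> \<longleftrightarrow> (\<forall>p q S. form_coeff \<omega> p S = form_coeff \<omega> q S)"
  unfolding constant_form_def fun_eq_iff by metis

lemma constant_formD: "constant_form \<omega> \<Longrightarrow> form_coeff \<omega> p S = form_coeff \<omega> q S"
  unfolding constant_form_iff by blast

lemma phi_derivative_constant: "constant_form \<omega> \<Longrightarrow> phi_derivative z \<omega> = (0 :: 'n::{finite,linorder} form)"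
proof (rule form_eqI)
  fix p S
  assume "constant_form \<omega>"
  then obtain c where "(\<lambda>p. form_coeff \<omega> p S) = (\<lambda>p. c)"
    unfolding constant_form_def by blast
  then show "form_coeff (phi_derivative z \<omega>) p S = form_coeff 0 p S"
    by (simp only: form_coeff_phi_derivative wirtinger_const form_coeff_zero)
qed

lemma constant_form_add: "constant_form \<omega> \<Longrightarrow> constant_form \<eta> \<Longrightarrow> constant_form (\<omega> + \<eta> :: 'n::{finite,linorder} form)"
  unfolding constant_form_iff form_coeff_add by metis

lemma constant_form_diff: "constant_form \<omega> \<Longrightarrow> constant_form \<eta> \<Longrightarrow> constant_form (\<omega> - \<eta> :: 'n::{finite,linorder} form)"
  unfolding constant_form_iff form_coeff_diff by metis

lemma constant_form_sum:
  "(\<And>i. i \<in> I \<Longrightarrow> constant_form (\<omega> i)) \<Longrightarrow> constant_form (\<Sum>i\<in>I. \<omega> i :: 'n::{finite,linorder} form)"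
  unfolding constant_form_iff form_coeff_sum by (blast intro: sum.cong)

lemma constant_form_mult: "constant_form \<omega> \<Longrightarrow> constant_form \<eta> \<Longrightarrow> constant_form (\<omega> * \<eta> :: 'n::{finite,linorder} form)"
  unfolding constant_form_iff form_coeff_mult by (intro allI sum.cong refl arg_cong2[where f = "(*)"]) blast+

lemma constant_form_const: "constant_form (const_form c)"
  by (simp add: constant_form_iff form_coeff_fun_form)

lemma phi_derivative_one [simp]: "phi_derivative z 1 = (0 :: 'n::{finite,linorder} form)"
  unfolding one_form_eq by (rule phi_derivative_constant[OF constant_form_const])

lemma constant_form_psi: "constant_form (psi x)" "constant_form (psi_bar x)"
proof -
  have "constant_form (coord_diff c)" for c :: "'a coord"
    by (simp add: constant_form_iff coord_diff_def)
  then show "constant_form (psi x)" "constant_form (psi_bar x)"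
    unfolding psi_def psi_bar_def dphi_def dphi_bar_def
    by (intro constant_form_mult constant_form_add constant_form_diff constant_form_const; assumption)+
qed

lemma constant_form_psi_quad: "constant_form (psi_quad A)"
  unfolding psi_quad_def by (intro constant_form_sum constant_form_mult constant_form_psi constant_form_const)

lemma constant_form_power: "constant_form \<omega> \<Longrightarrow> constant_form (\<omega> ^ n :: 'n::{finite,linorder} form)"
  by (induction n) (simp_all add: one_form_eq constant_form_const constant_form_mult)

lemma constant_form_fermi_exp: "constant_form (fermi_exp A)"
  unfolding fermi_exp_def
  by (intro constant_form_sum constant_form_mult constant_form_const constant_form_power constant_form_psi_quad)

section \<open>Coercivity of the quadratic form\<close>

text \<open>
  The sum in the definition of positive Hermitian part is \<open>\<phi>A\<phi>*\<close> plus its conjugate, and \<open>p \<mapsto> \<phi>\<close> identifies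
  \<open>\<real>\<^sup>2\<^sup>M\<close> with the complex vectors.
\<close>

lemma positive_hermitian_part_iff:
  fixes A :: "complex^'n^'n"
  shows "positive_hermitian_part A \<longleftrightarrow> (\<forall>p. p \<noteq> 0 \<longrightarrow> 0 < Re (phi_quad A p))"
proof -
  define v where "v = (\<lambda>p :: (real^'n) \<times> (real^'n). \<chi> x. phi x p)"
  have v: "v p = 0 \<longleftrightarrow> p = 0" for p
    by (cases p) (auto simp: v_def vec_eq_iff phi_def complex_eq_iff zero_prod_def)
  have surj: "\<exists>p. v p = \<phi>" for \<phi>
    by (rule exI[of _ "(\<chi> x. Re (\<phi> $ x), \<chi> x. Im (\<phi> $ x))"]) (simp add: v_def vec_eq_iff phi_def complex_eq_iff)
  have bar: "phi_bar x p = cnj (phi x p)" for x p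
    by (simp add: phi_def phi_bar_def split_beta)
  have Re: "Re (\<Sum>x\<in>UNIV. \<Sum>y\<in>UNIV. v p $ x * (A $ x $ y + cnj (A $ y $ x)) * cnj (v p $ y)) = 2 * Re (phi_quad A p)" for p
  proof -
    have "(\<Sum>x\<in>UNIV. \<Sum>y\<in>UNIV. v p $ x * cnj (A $ y $ x) * cnj (v p $ y)) =
        (\<Sum>y\<in>UNIV. \<Sum>x\<in>UNIV. v p $ x * cnj (A $ y $ x) * cnj (v p $ y))"
      by (rule sum.swap)
    also have "\<dots> = cnj (phi_quad A p)"
      by (simp add: phi_quad_def bar v_def mult_ac)
    finally have "(\<Sum>x\<in>UNIV. \<Sum>y\<in>UNIV. v p $ x * (A $ x $ y + cnj (A $ y $ x)) * cnj (v p $ y)) =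
        phi_quad A p + cnj (phi_quad A p)"
      by (simp add: distrib_left distrib_right sum.distrib phi_quad_def bar v_def)
    then show ?thesis by simp
  qed
  show ?thesis
    unfolding positive_hermitian_part_def
  proof (intro iffI allI impI)
    fix p :: "(real^'n) \<times> (real^'n)"
    assume *: "\<forall>\<phi>. \<phi> \<noteq> 0 \<longrightarrow> 0 < Re (\<Sum>x\<in>UNIV. \<Sum>y\<in>UNIV. \<phi> $ x * (A $ x $ y + cnj (A $ y $ x)) * cnj (\<phi> $ y))"
      and "p \<noteq> 0"
    then have "v p \<noteq> 0" using v by blast
    then have "0 < 2 * Re (phi_quad A p)" using * unfolding Re[symmetric] by blast
    then show "0 < Re (phi_quad A p)" by simp
  next
    fix \<phi> :: "complex^'n"
    assume *: "\<forall>p. p \<noteq> 0 \<longrightarrow> 0 < Re (phi_quad A p)" and "\<phi> \<noteq> 0"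
    obtain p where p: "\<phi> = v p" using surj by metis
    then have "0 < 2 * Re (phi_quad A p)" using * \<open>\<phi> \<noteq> 0\<close> v[of p] by (metis mult_pos_pos zero_less_numeral)
    then show "0 < Re (\<Sum>x\<in>UNIV. \<Sum>y\<in>UNIV. \<phi> $ x * (A $ x $ y + cnj (A $ y $ x)) * cnj (\<phi> $ y))"
      unfolding p Re .
  qed
qed

text \<open>
  The constant is the minimum of \<open>Re (\<phi>A\<phi>*)\<close> over the unit sphere; the rest is homogeneity of degree two.
\<close>

lemma positive_hermitian_part_coercive:
  fixes A :: "complex^'n^'n"
  assumes "positive_hermitian_part A"
  obtains c where "c > 0" "\<And>p. c * (norm p)\<^sup>2 \<le> Re (phi_quad A p)"
proof -
  have "continuous_on (sphere 0 1) (\<lambda>p. Re (phi_quad A p))"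
    by (intro continuous_intros cpoly_continuous cpoly_phi_quad)
  moreover have "sphere (0 :: (real^'n) \<times> (real^'n)) 1 \<noteq> {}"
    by simp
  ultimately obtain q where q: "q \<in> sphere 0 1" "\<And>p. p \<in> sphere 0 1 \<Longrightarrow> Re (phi_quad A q) \<le> Re (phi_quad A p)"
    using continuous_attains_inf[OF compact_sphere] by blast
  show thesis
  proof
    show "Re (phi_quad A q) > 0"
    proof -
      have "q \<noteq> 0" using q(1) by auto
      then show ?thesis using assms unfolding positive_hermitian_part_iff by blast
    qed
    fix p :: "(real^'n) \<times> (real^'n)"
    show "Re (phi_quad A q) * (norm p)\<^sup>2 \<le> Re (phi_quad A p)"
    proof (cases "p = 0")
      case True
      then show ?thesis by (simp add: phi_quad_def phi_def split_beta)
    next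
      case False
      define r where "r = (1 / norm p) *\<^sub>R p"
      have "phi x p = of_real (norm p) * phi x r" "phi_bar x p = of_real (norm p) * phi_bar x r" for x
        using False by (simp_all add: phi_def phi_bar_def r_def split_beta algebra_simps)
      then have "phi_quad A p = of_real ((norm p)\<^sup>2) * phi_quad A r"
        by (simp add: phi_quad_def sum_distrib_left power2_eq_square mult_ac)
      then have "Re (phi_quad A p) = (norm p)\<^sup>2 * Re (phi_quad A r)"
        by simp
      moreover have "r \<in> sphere 0 1" using False by (simp add: r_def)
      ultimately show ?thesis using q(2)[of r] by (auto simp: mult.commute[of "(norm p)\<^sup>2"] intro!: mult_right_mono)
    qed
  qed
qed

section \<open>Integration by parts against \<open>e\<^bsup>-S\<^esup>\<close>\<close>

definition super_expectation :: "complex^'n::{finite,linorder}^'n::{finite,linorder} \<Rightarrow> 'n form \<Rightarrow> complex" where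
  "super_expectation A F = form_integral (exp_neg_S A * F)"

lemma form_coeff_exp_neg_S_mult:
  "form_coeff (exp_neg_S A * F) p S = exp (- phi_quad A p) * form_coeff (fermi_exp A * F) p S"
  by (simp add: exp_neg_S_eq mult.assoc)

lemma form_integrable_exp_neg_S_mult:
  assumes "positive_hermitian_part A" "poly_form F"
  shows "form_integrable (exp_neg_S A * F)"
proof -
  obtain c where c: "c > 0" "\<And>p. c * (norm p)\<^sup>2 \<le> Re (phi_quad A p)"
    using positive_hermitian_part_coercive[OF assms(1)] by blast
  have "cpoly (\<lambda>p. form_coeff (fermi_exp A * F) p UNIV)"
    by (intro poly_formD poly_form_mult poly_form_fermi_exp assms)
  then show ?thesis
    unfolding form_integrable_def form_coeff_exp_neg_S_mult
    by (rule integrable_exp_mult_cpoly[OF cpoly_phi_quad c])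
qed

lemma super_expectation_add:
  assumes "positive_hermitian_part A" "poly_form F" "poly_form G"
  shows "super_expectation A (F + G) = super_expectation A F + super_expectation A G"
  using form_integrable_exp_neg_S_mult[OF assms(1,2)] form_integrable_exp_neg_S_mult[OF assms(1,3)]
  by (simp add: super_expectation_def form_integral_def form_integrable_def distrib_left)

lemma super_expectation_const_mult: "super_expectation A (const_form c * F) = c * super_expectation A F"
  by (simp add: super_expectation_def form_integral_def fun_form_left_commute[of "exp_neg_S A"])

lemma super_expectation_zero [simp]: "super_expectation A 0 = 0"
  by (simp add: super_expectation_def form_integral_def)

lemma super_expectation_diff:
  assumes "positive_hermitian_part A" "poly_form F" "poly_form G"
  shows "super_expectation A (F - G) = super_expectation A F - super_expectation A G"
  using form_integrable_exp_neg_S_mult[OF assms(1,2)] form_integrable_exp_neg_S_mult[OF assms(1,3)]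
  by (simp add: super_expectation_def form_integral_def form_integrable_def right_diff_distrib)

lemma super_expectation_sum:
  assumes "positive_hermitian_part A" "\<And>i. i \<in> I \<Longrightarrow> poly_form (F i)"
  shows "super_expectation A (\<Sum>i\<in>I. F i) = (\<Sum>i\<in>I. super_expectation A (F i))"
  using assms(2)
proof (induction I rule: infinite_finite_induct)
  case (insert i I)
  then show ?case by (simp add: super_expectation_add[OF assms(1)] poly_form_sum)
qed simp_all

text \<open>
  The scalar integration by parts for the directions \<open>u\<^sub>z\<close> and \<open>v\<^sub>z\<close>, applied to the top coefficient of \<open>e\<^bsup>-\<psi>A\<psi>*\<^esup> F\<close> and
  combined as in the Wirtinger derivative, which takes \<open>\<phi>A\<phi>*\<close> to \<open>\<Sum>\<^sub>y A\<^sub>z\<^sub>y \<phi>*\<^sub>y\<close>.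
\<close>

lemma super_expectation_phi_derivative:
  assumes A: "positive_hermitian_part A" and F: "poly_form F"
  shows "super_expectation A (phi_derivative z F) =
    (\<Sum>y\<in>UNIV. A $ z $ y * super_expectation A (fun_form (phi_bar y) * F))"
proof -
  obtain c where c: "c > 0" "\<And>p. c * (norm p)\<^sup>2 \<le> Re (phi_quad A p)"
    using positive_hermitian_part_coercive[OF A] by blast
  define q where "q = (\<lambda>p. form_coeff (fermi_exp A * F) p UNIV)"
  have q: "cpoly q"
    unfolding q_def by (intro poly_formD poly_form_mult poly_form_fermi_exp F)
  note int = integrable_exp_mult_cpoly[OF cpoly_phi_quad c]
  note parts = integral_by_parts_exp_cpoly[OF cpoly_phi_quad c q]
  have i: "integrable lborel (\<lambda>p. exp (- phi_quad A p) * frechet_derivative q (at p) e)"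
    "integrable lborel (\<lambda>p. exp (- phi_quad A p) * (frechet_derivative (phi_quad A) (at p) e * q p))" for e
    by (intro int cpoly_mult cpoly_frechet_derivative cpoly_phi_quad q)+
  have "fermi_exp A * phi_derivative z F = phi_derivative z (fermi_exp A * F)"
    by (simp add: phi_derivative_mult poly_form_fermi_exp F phi_derivative_constant constant_form_fermi_exp)
  then have "super_expectation A (phi_derivative z F) = (\<integral>p. exp (- phi_quad A p) * wirtinger z q p \<partial>lborel)"
    by (simp add: super_expectation_def form_integral_def form_coeff_exp_neg_S_mult q_def)
  also have "\<dots> = (\<integral>p. (exp (- phi_quad A p) * frechet_derivative q (at p) (axis z 1, 0)
      - \<i> * (exp (- phi_quad A p) * frechet_derivative q (at p) (0, axis z 1))) / 2 \<partial>lborel)"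
    by (intro Bochner_Integration.integral_cong refl) (simp add: wirtinger_def field_simps)
  also have "\<dots> = (\<integral>p. (exp (- phi_quad A p) * (frechet_derivative (phi_quad A) (at p) (axis z 1, 0) * q p)
      - \<i> * (exp (- phi_quad A p) * (frechet_derivative (phi_quad A) (at p) (0, axis z 1) * q p))) / 2 \<partial>lborel)"
    by (simp add: i parts)
  also have "\<dots> = (\<integral>p. exp (- phi_quad A p) * (wirtinger z (phi_quad A) p * q p) \<partial>lborel)"
    by (intro Bochner_Integration.integral_cong refl) (simp add: wirtinger_def field_simps)
  also have "\<dots> = super_expectation A (\<Sum>y\<in>UNIV. const_form (A $ z $ y) * (fun_form (phi_bar y) * F))"
    unfolding super_expectation_def form_integral_def form_coeff_exp_neg_S_mult
    by (simp add: q_def wirtinger_phi_quad sum_distrib_left sum_distrib_right fun_form_left_commute[of "fermi_exp A"] mult_ac)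
  also have "\<dots> = (\<Sum>y\<in>UNIV. A $ z $ y * super_expectation A (fun_form (phi_bar y) * F))"
    by (subst super_expectation_sum[OF A])
       (auto simp: super_expectation_const_mult intro!: poly_form_intros cpoly_const F)
  finally show ?thesis .
qed

text \<open>
  The form \<open>\<partial>/\<partial>\<psi>\<^sub>z (e\<^bsup>-\<psi>A\<psi>*\<^esup> F)\<close> has no part of top degree, and \<open>e\<^bsup>-\<psi>A\<psi>*\<^esup>\<close> is even.
\<close>

lemma super_expectation_psi_derivative:
  assumes A: "positive_hermitian_part A" and F: "poly_form F"
  shows "super_expectation A (psi_derivative z F) =
    (\<Sum>y\<in>UNIV. A $ z $ y * super_expectation A (psi_bar y * F))"
proof -
  have "fermi_exp A * psi_derivative z F = psi_derivative z (fermi_exp A * F) - psi_derivative z (fermi_exp A) * F"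
    by (simp add: psi_derivative_even_mult)
  also have "psi_derivative z (fermi_exp A) * F = - (fermi_exp A * (\<Sum>y\<in>UNIV. const_form (A $ z $ y) * (psi_bar y * F)))"
    by (simp add: psi_derivative_fermi_exp sum_distrib_right sum_distrib_left mult.assoc
        fun_form_left_commute[of "fermi_exp A"] even_form_commute[of "fermi_exp A" "psi_bar _ * _"]
        even_form_commute[of "fermi_exp A" F])
  finally have "form_coeff (fermi_exp A * psi_derivative z F) p UNIV =
      form_coeff (fermi_exp A * (\<Sum>y\<in>UNIV. const_form (A $ z $ y) * (psi_bar y * F))) p UNIV" for p
    by (simp del: form_coeff_sum)
  then have "super_expectation A (psi_derivative z F) =
      super_expectation A (\<Sum>y\<in>UNIV. const_form (A $ z $ y) * (psi_bar y * F))"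
    unfolding super_expectation_def form_integral_def form_coeff_exp_neg_S_mult by simp
  also have "\<dots> = (\<Sum>y\<in>UNIV. A $ z $ y * super_expectation A (psi_bar y * F))"
    by (subst super_expectation_sum[OF A])
       (auto simp: super_expectation_const_mult intro!: poly_form_intros cpoly_const F)
  finally show ?thesis .
qed

lemma matrix_inv_solve:
  fixes A :: "complex^'n^'n"
  assumes "invertible A" and f: "\<And>z. f z = (\<Sum>y\<in>UNIV. A $ z $ y * g y)"
  shows "g w = (\<Sum>z\<in>UNIV. matrix_inv A $ w $ z * f z)"
proof -
  have "(\<chi> z. f z) = A *v (\<chi> y. g y)"
    by (simp add: vec_eq_iff matrix_vector_mult_def f)
  moreover have "matrix_inv A ** A = mat 1"
    using assms(1) unfolding matrix_inv_def invertible_def by (rule someI2_ex) blast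
  ultimately have "matrix_inv A *v (\<chi> z. f z) = (\<chi> y. g y)"
    by (simp add: matrix_vector_mul_assoc)
  then have "(matrix_inv A *v (\<chi> z. f z)) $ w = g w" by simp
  then show ?thesis by (simp add: matrix_vector_mult_def)
qed

lemma super_expectation_phi_bar:
  assumes A: "positive_hermitian_part A" and F: "poly_form F"
  shows "super_expectation A (fun_form (phi_bar w) * F) =
    (\<Sum>z\<in>UNIV. matrix_inv A $ w $ z * super_expectation A (phi_derivative z F))"
  by (rule matrix_inv_solve[OF positive_hermitian_part_invertible[OF A] super_expectation_phi_derivative[OF A F]])

lemma super_expectation_psi_bar:
  assumes A: "positive_hermitian_part A" and F: "poly_form F"
  shows "super_expectation A (psi_bar w * F) =
    (\<Sum>z\<in>UNIV. matrix_inv A $ w $ z * super_expectation A (psi_derivative z F))"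
  by (rule matrix_inv_solve[OF positive_hermitian_part_invertible[OF A] super_expectation_psi_derivative[OF A F]])

section \<open>Products of \<open>1 + \<tau>\<^sub>x\<close>\<close>

lemma ordered_prod_remove:
  fixes f :: "'i::linorder \<Rightarrow> 'a::monoid_mult"
  assumes comm: "\<And>x y. f x * f y = f y * f x" and "finite X" "x \<in> X"
  shows "ordered_prod f X = f x * ordered_prod f (X - {x})"
proof -
  have "prod_list (map f xs) = f x * prod_list (map f (remove1 x xs))" if "x \<in> set xs" for xs
    using that
  proof (induction xs)
    case (Cons y xs)
    show ?case
    proof (cases "x = y")
      case False
      then have "prod_list (map f (y # xs)) = f y * (f x * prod_list (map f (remove1 x xs)))"
        using Cons by simp
      also have "\<dots> = f x * (f y * prod_list (map f (remove1 x xs)))"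
        by (simp add: comm[of y x] flip: mult.assoc)
      finally show ?thesis using False by simp
    qed simp
  qed simp
  then show ?thesis
    using assms(2,3) by (simp add: ordered_prod_def sorted_list_of_set_remove)
qed

abbreviation tau_prod :: "'n::{finite,linorder} set \<Rightarrow> 'n form" where
  "tau_prod X \<equiv> ordered_prod (\<lambda>x. 1 + tau x) X"

lemma grade_inv_tau [simp]: "grade_inv (tau x) = tau x"
  by (simp add: tau_def grade_inv_mult)

lemma poly_form_tau: "poly_form (tau x)"
  unfolding tau_def by (intro poly_form_intros cpoly_mult cpoly_phi)

lemma tau_prod_remove: "x \<in> X \<Longrightarrow> tau_prod X = (1 + tau x) * tau_prod (X - {x})"
  by (rule ordered_prod_remove) (simp_all add: even_form_commute)

lemma tau_prod_induct [case_names empty step]: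
  assumes "P (tau_prod {})" and "\<And>x X. x \<in> X \<Longrightarrow> P (tau_prod (X - {x})) \<Longrightarrow> P ((1 + tau x) * tau_prod (X - {x}))"
  shows "P (tau_prod X)"
  using finite[of X]
proof (induction X rule: finite_induct)
  case (insert x X)
  then have "P ((1 + tau x) * tau_prod (insert x X - {x}))"
    by (intro assms(2)) simp_all
  then show ?case by (simp only: tau_prod_remove[OF insertI1[of x X]])
qed (rule assms(1))

lemma tau_prod_empty [simp]: "tau_prod {} = 1"
  by (simp add: ordered_prod_def)

lemma poly_form_tau_prod: "poly_form (tau_prod X)"
  by (rule tau_prod_induct) (auto intro: poly_form_intros poly_form_tau)

lemma grade_inv_tau_prod [simp]: "grade_inv (tau_prod X) = tau_prod X"
  by (rule tau_prod_induct) (auto simp: grade_inv_mult)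

lemma phi_derivative_tau: "phi_derivative z (1 + tau x) = (if x = z then fun_form (phi_bar z) else 0)"
proof -
  have "phi_derivative z (1 + tau x) = fun_form (wirtinger z (\<lambda>p. phi x p * phi_bar x p))"
    unfolding tau_def
    by (simp add: phi_derivative_add poly_form_intros cpoly_mult phi_derivative_fun_form
        phi_derivative_constant constant_form_mult constant_form_psi)
  then show ?thesis
    by (intro form_eqI) (simp add: form_coeff_fun_form wirtinger_mult)
qed

lemma psi_derivative_tau: "psi_derivative z (1 + tau x) = (if x = z then psi_bar z else 0)"
  by (simp add: tau_def psi_derivative_mult)

lemma derivatives_tau_prod_notin:
  assumes "z \<notin> X"
  shows "phi_derivative z (tau_prod X) = 0" "psi_derivative z (tau_prod X) = 0"
proof -
  have "phi_derivative z (tau_prod X) = 0 \<and> psi_derivative z (tau_prod X) = 0"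
    using finite[of X] assms
  proof (induction X rule: finite_induct)
    case empty
    show ?case by simp
  next
    case (insert x X)
    then have "x \<noteq> z" by auto
    with insert show ?case
      by (simp add: tau_prod_remove[of x "insert x X"] phi_derivative_mult poly_form_add poly_form_one
          poly_form_tau poly_form_tau_prod phi_derivative_tau psi_derivative_even_mult psi_derivative_tau
          del: psi_derivative_add)
  qed
  then show "phi_derivative z (tau_prod X) = 0" "psi_derivative z (tau_prod X) = 0" by auto
qed

lemma phi_derivative_tau_prod:
  "phi_derivative z (tau_prod X) = (if z \<in> X then fun_form (phi_bar z) * tau_prod (X - {z}) else 0)"
  by (simp add: derivatives_tau_prod_notin tau_prod_remove[of z X] phi_derivative_mult poly_form_add
      poly_form_one poly_form_tau poly_form_tau_prod phi_derivative_tau)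

lemma psi_derivative_tau_prod:
  "psi_derivative z (tau_prod X) = (if z \<in> X then psi_bar z * tau_prod (X - {z}) else 0)"
  by (simp add: derivatives_tau_prod_notin tau_prod_remove[of z X] psi_derivative_even_mult psi_derivative_tau
      del: psi_derivative_add)

text \<open>
  The derivative in \<open>\<phi>\<^sub>z\<close> hits \<open>\<phi>\<^sub>b\<close> if \<open>z = b\<close>, and the factor \<open>1 + \<tau>\<^sub>z\<close> if \<open>z \<in> X\<close>; in the second case it leaves
  \<open>\<phi>*\<^sub>z\<close> in place of that factor.
\<close>

lemma super_expectation_phi_bar_phi:
  assumes A: "positive_hermitian_part A" and b: "b \<notin> X"
  shows "super_expectation A (fun_form (phi_bar a) * (fun_form (phi b) * tau_prod X)) =
    matrix_inv A $ a $ b * super_expectation A (tau_prod X) +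
    (\<Sum>x\<in>X. matrix_inv A $ a $ x * super_expectation A (fun_form (phi_bar x) * (fun_form (phi b) * tau_prod (X - {x}))))"
proof -
  have d: "phi_derivative z (fun_form (phi b) * tau_prod X) = (if b = z then tau_prod X else 0) +
      (if z \<in> X then fun_form (phi_bar z) * (fun_form (phi b) * tau_prod (X - {z})) else 0)" for z
    by (simp add: phi_derivative_mult poly_form_fun_form poly_form_tau_prod phi_derivative_fun_form phi_derivative_tau_prod
         fun_form_left_commute[of "fun_form _"])
       (auto intro!: form_eqI)
  have "super_expectation A (fun_form (phi_bar a) * (fun_form (phi b) * tau_prod X)) =
     (\<Sum>z\<in>UNIV. (if z = b then matrix_inv A $ a $ b * super_expectation A (tau_prod X) else 0) +
      (if z \<in> X then matrix_inv A $ a $ z * super_expectation A (fun_form (phi_bar z) * (fun_form (phi b) * tau_prod (X - {z}))) else 0))"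
    by (subst super_expectation_phi_bar[OF A poly_form_mult[OF poly_form_fun_form[OF cpoly_phi(1)] poly_form_tau_prod]], unfold d)
       (use b in \<open>auto intro!: sum.cong\<close>)
  then show ?thesis
    by (simp add: sum.distrib sum.inter_restrict[symmetric])
qed

text \<open>
  Word for word the bosonic recursion: the sign from moving the derivative past \<open>\<psi>\<^sub>b\<close> is undone by
  \<open>\<psi>\<^sub>b \<psi>*\<^sub>z = - \<psi>*\<^sub>z \<psi>\<^sub>b\<close>.
\<close>

lemma super_expectation_psi_bar_psi:
  assumes A: "positive_hermitian_part A" and b: "b \<notin> X"
  shows "super_expectation A (psi_bar a * (psi b * tau_prod X)) =
    matrix_inv A $ a $ b * super_expectation A (tau_prod X) +
    (\<Sum>x\<in>X. matrix_inv A $ a $ x * super_expectation A (psi_bar x * (psi b * tau_prod (X - {x}))))"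
proof -
  have d: "psi_derivative z (psi b * tau_prod X) = (if b = z then tau_prod X else 0) +
      (if z \<in> X then psi_bar z * (psi b * tau_prod (X - {z})) else 0)" for z
    by (simp add: psi_derivative_mult psi_derivative_tau_prod psi_psi_bar_anticommute flip: mult.assoc)
  have "super_expectation A (psi_bar a * (psi b * tau_prod X)) =
     (\<Sum>z\<in>UNIV. (if z = b then matrix_inv A $ a $ b * super_expectation A (tau_prod X) else 0) +
      (if z \<in> X then matrix_inv A $ a $ z * super_expectation A (psi_bar z * (psi b * tau_prod (X - {z}))) else 0))"
    by (subst super_expectation_psi_bar[OF A poly_form_mult[OF poly_form_psi(1) poly_form_tau_prod]], unfold d)
       (use b in \<open>auto intro!: sum.cong\<close>)
  then show ?thesis
    by (simp add: sum.distrib sum.inter_restrict[symmetric])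
qed

text \<open>
  Both sides obey the same recursion on \<open>X\<close>, with the same coefficients.
\<close>

lemma boson_fermion_cancel:
  assumes A: "positive_hermitian_part A" and b: "b \<notin> X"
  shows "super_expectation A (fun_form (phi_bar a) * (fun_form (phi b) * tau_prod X)) =
    super_expectation A (psi_bar a * (psi b * tau_prod X))"
  using finite[of X] b
proof (induction X arbitrary: a rule: finite_psubset_induct)
  case (psubset X)
  then show ?case
    unfolding super_expectation_phi_bar_phi[OF A psubset.prems] super_expectation_psi_bar_psi[OF A psubset.prems]
    by (intro arg_cong2[where f = "(+)"] sum.cong arg_cong2[where f = "(*)"] refl psubset.IH) auto
qed

text \<open>
  Expanding one factor \<open>1 + \<tau>\<^sub>x = 1 + \<phi>*\<^sub>x \<phi>\<^sub>x - \<psi>*\<^sub>x \<psi>\<^sub>x\<close>, the last two terms cancel.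
\<close>

lemma super_expectation_tau_prod:
  assumes A: "positive_hermitian_part A"
  shows "super_expectation A (tau_prod X) = super_expectation A 1"
  using finite[of X]
proof (induction X rule: finite_induct)
  case (insert x X)
  have "tau_prod (insert x X) = (tau_prod X + fun_form (phi_bar x) * (fun_form (phi x) * tau_prod X)) - psi_bar x * (psi x * tau_prod X)"
  proof -
    have "tau_prod (insert x X) = (1 + tau x) * tau_prod X"
      using insert.hyps by (simp add: tau_prod_remove[of x "insert x X"])
    also have "(1 + tau x) * \<omega> = (\<omega> + fun_form (phi_bar x) * (fun_form (phi x) * \<omega>)) - psi_bar x * (psi x * \<omega>)" for \<omega>
      by (simp add: tau_def distrib_right left_diff_distrib fun_form_mult psi_psi_bar_anticommute mult.assoc
          fun_form_left_commute[of "fun_form (phi_bar x)"])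
    finally show ?thesis .
  qed
  then have "super_expectation A (tau_prod (insert x X)) =
     super_expectation A (tau_prod X) + super_expectation A (fun_form (phi_bar x) * (fun_form (phi x) * tau_prod X)) - super_expectation A (psi_bar x * (psi x * tau_prod X))"
    by (simp add: super_expectation_add[OF A] super_expectation_diff[OF A] poly_form_intros poly_form_tau_prod cpoly_phi)
  then show ?case
    using insert boson_fermion_cancel[OF A insert.hyps(2)] by simp
qed simp

section \<open>The partition function\<close>

definition has_form_derivative :: "(real \<Rightarrow> 'n::finite form) \<Rightarrow> 'n form \<Rightarrow> real filter \<Rightarrow> bool" where
  "has_form_derivative \<omega> \<omega>' F \<longleftrightarrow>
     (\<forall>p S. ((\<lambda>s. form_coeff (\<omega> s) p S) has_vector_derivative form_coeff \<omega>' p S) F)"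

lemma has_form_derivativeD:
  "has_form_derivative \<omega> \<omega>' F \<Longrightarrow>
    ((\<lambda>s. form_coeff (\<omega> s) p S) has_vector_derivative form_coeff \<omega>' p S) F"
  unfolding has_form_derivative_def by blast

lemma has_form_derivative_mult:
  fixes \<omega> \<eta> :: "real \<Rightarrow> 'n::{finite,linorder} form"
  assumes "has_form_derivative \<omega> \<omega>' (at t within T)" "has_form_derivative \<eta> \<eta>' (at t within T)"
  shows "has_form_derivative (\<lambda>s. \<omega> s * \<eta> s) (\<omega>' * \<eta> t + \<omega> t * \<eta>') (at t within T)"
  unfolding has_form_derivative_def
proof (intro allI)
  fix p and S :: "'n coord set"
  have "((\<lambda>s. \<Sum>U\<in>Pow S. wedge_sign U (S - U) * (form_coeff (\<omega> s) p U * form_coeff (\<eta> s) p (S - U))) has_vector_derivative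
     (\<Sum>U\<in>Pow S. wedge_sign U (S - U) * (form_coeff (\<omega> t) p U * form_coeff \<eta>' p (S - U) + form_coeff \<omega>' p U * form_coeff (\<eta> t) p (S - U)))) (at t within T)"
    by (intro has_vector_derivative_sum has_vector_derivative_mult_right has_vector_derivative_mult
        has_form_derivativeD[OF assms(1)] has_form_derivativeD[OF assms(2)])
  then show "((\<lambda>s. form_coeff (\<omega> s * \<eta> s) p S) has_vector_derivative form_coeff (\<omega>' * \<eta> t + \<omega> t * \<eta>') p S) (at t within T)"
    by (simp add: form_coeff_mult sum.distrib distrib_left mult.assoc add.commute)
qed

lemma has_form_derivative_fermi_exp:
  fixes A :: "real \<Rightarrow> complex^'n::{finite,linorder}^'n::{finite,linorder}"
  assumes N: "\<And>s. psi_quad (A s) = N0 + const_form (of_real s) * psi_quad B"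
  shows "has_form_derivative (\<lambda>s. fermi_exp (A s)) (- (psi_quad B * fermi_exp (A t))) (at t within T)"
proof -
  define d where "d = rec_nat 0 (\<lambda>n r. psi_quad B * psi_quad (A t) ^ n + psi_quad (A t) * r)"
  have d: "d 0 = 0" "d (Suc n) = psi_quad B * psi_quad (A t) ^ n + psi_quad (A t) * d n" for n
    by (simp_all add: d_def)
  have "has_form_derivative (\<lambda>s. psi_quad (A s)) (psi_quad B) (at t within T)"
    unfolding has_form_derivative_def N
    by (auto intro!: derivative_eq_intros)
  note step = has_form_derivative_mult[OF this]
  have pow: "has_form_derivative (\<lambda>s. psi_quad (A s) ^ n) (d n) (at t within T)" for n
  proof (induction n)
    case 0
    show ?case by (simp add: d has_form_derivative_def)
  next
    case (Suc n)
    then show ?case unfolding d(2) power_Suc by (rule step)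
  qed
  have "has_form_derivative (\<lambda>s. fermi_exp (A s)) (\<Sum>n = 0..CARD('n). const_form ((-1) ^ n / fact n) * d n) (at t within T)"
    using pow unfolding has_form_derivative_def fermi_exp_def form_coeff_sum form_coeff_fun_form_mult
    by (intro allI has_vector_derivative_sum has_vector_derivative_mult_right) auto
  also have "(\<Sum>n = 0..CARD('n). const_form ((-1) ^ n / fact n) * d n) = - (psi_quad B * fermi_exp (A t))"
    unfolding fermi_exp_def
    by (intro truncated_exp_derivative d(1) psi_quad_mult_power_zero even_power_derivative d(2)) (simp_all add: d)
  finally show ?thesis .
qed

lemma phi_quad_one: "phi_quad (mat 1) p = of_real ((norm p)\<^sup>2)"
proof -
  obtain u v where p: "p = (u, v)" by (cases p)
  have "phi_quad (mat 1) p = (\<Sum>x\<in>UNIV. \<Sum>y\<in>UNIV. if y = x then phi x p * phi_bar x p else 0)"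
    unfolding phi_quad_def by (intro sum.cong) (auto simp: mat_def)
  also have "\<dots> = (\<Sum>x\<in>UNIV. of_real ((u $ x)\<^sup>2 + (v $ x)\<^sup>2))"
    unfolding p by (simp add: phi_def phi_bar_def algebra_simps power2_eq_square)
  also have "\<dots> = of_real ((norm p)\<^sup>2)"
    unfolding p power2_norm_eq_inner inner_prod_def
    by (simp add: inner_vec_def sum.distrib power2_eq_square)
  finally show ?thesis .
qed

lemma super_expectation_one_factor:
  "super_expectation A 1 = form_coeff (fermi_exp A) 0 UNIV * (\<integral>p. exp (- phi_quad A p) \<partial>lborel)"
proof -
  have "form_coeff (exp_neg_S A * 1) p UNIV = form_coeff (fermi_exp A) 0 UNIV * exp (- phi_quad A p)" for p
    using constant_formD[OF constant_form_fermi_exp, of A p UNIV 0]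
    unfolding form_coeff_exp_neg_S_mult by simp
  then show ?thesis
    unfolding super_expectation_def form_integral_def by simp
qed

lemma super_expectation_one_mat_one:
  "super_expectation (mat 1 :: complex^'n::{finite,linorder}^'n::{finite,linorder}) 1 = 1"
proof -
  have "has_bochner_integral lborel (\<lambda>p::(real, 'n) vec \<times> (real, 'n) vec. exp (- 1 * (norm p)\<^sup>2)) (sqrt (pi / 1) ^ DIM((real, 'n) vec \<times> (real, 'n) vec))"
    by (rule has_bochner_integral_gaussian) simp
  then have gauss: "(\<integral>p. exp (- (norm (p::(real, 'n) vec \<times> (real, 'n) vec))\<^sup>2) \<partial>lborel) = pi ^ CARD('n)"
    by (simp add: has_bochner_integral_iff power_mult flip: mult_2)
  have "(\<integral>p. exp (- phi_quad (mat 1 :: complex^'n::{finite,linorder}^'n::{finite,linorder}) p) \<partial>lborel) =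
      (\<integral>p. of_real (exp (- (norm (p::(real, 'n) vec \<times> (real, 'n) vec))\<^sup>2)) \<partial>lborel)"
    by (simp add: phi_quad_one exp_of_real flip: of_real_minus of_real_power)
  then have "super_expectation (mat 1 :: complex^'n::{finite,linorder}^'n::{finite,linorder}) 1 =
      (1 / of_real pi) ^ CARD('n) * of_real (pi ^ CARD('n))"
    unfolding super_expectation_one_factor form_coeff_UNIV_fermi_exp_one by (simp add: gauss)
  also have "\<dots> = 1"
    by (simp flip: power_mult_distrib)
  finally show ?thesis .
qed

text \<open>
  Along the segment from the identity matrix to \<open>A\<close> the number \<open>E(1)\<close> is the product of the top coefficient \<open>D\<close> of
  \<open>e\<^bsup>-\<psi>A\<psi>*\<^esup>\<close> and the Gaussian integral \<open>Z\<close>. With \<open>B = A - 1\<close>, the derivative of the product is minus the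
  expectation of \<open>\<phi>B\<phi>* + \<psi>B\<psi>*\<close>, which vanishes by the cancellation between bosons and fermions. A convex
  combination of coercive quadratic forms is coercive with a uniform constant, which allows to differentiate \<open>Z\<close> under the integral.
\<close>

lemma super_expectation_one:
  fixes A :: "complex^'n::{finite,linorder}^'n::{finite,linorder}"
  assumes A: "positive_hermitian_part A"
  shows "super_expectation A 1 = 1"
proof -
  define B where "B = A - mat 1"
  define P where "P = (\<lambda>s::real. mat 1 + s *\<^sub>R B)"
  obtain c where c: "c > 0" "\<And>p. c * (norm p)\<^sup>2 \<le> Re (phi_quad A p)"
    using positive_hermitian_part_coercive[OF A] by blast
  have phi_P: "phi_quad (P s) p = phi_quad (mat 1) p + of_real s * phi_quad B p" for s p
    by (simp add: phi_quad_def P_def sum_distrib_left algebra_simps sum.distrib scaleR_conv_of_real[where 'a = complex])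
  have psi_P: "psi_quad (P s) = psi_quad (mat 1) + const_form (of_real s) * psi_quad B" for s
    by (rule form_eqI)
       (simp add: psi_quad_def P_def sum_distrib_left algebra_simps sum.distrib scaleR_conv_of_real[where 'a = complex])
  define m where "m = min 1 c"
  have m: "m > 0" using c(1) by (simp add: m_def)
  have coercive: "m * (norm p)\<^sup>2 \<le> Re (phi_quad (P s) p)" if s: "s \<in> {0..1}" for s p
  proof -
    have "phi_quad A p = phi_quad (mat 1) p + phi_quad B p"
      using phi_P[of 1 p] by (simp add: P_def B_def)
    then have "Re (phi_quad (P s) p) = (1 - s) * (norm p)\<^sup>2 + s * Re (phi_quad A p)"
      by (simp add: phi_P phi_quad_one algebra_simps)
    moreover have "(1 - s) * (m * (norm p)\<^sup>2) \<le> (1 - s) * (norm p)\<^sup>2"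
      using s mult_right_mono[of m 1 "(norm p)\<^sup>2"] by (intro mult_left_mono) (auto simp: m_def)
    moreover have "s * (m * (norm p)\<^sup>2) \<le> s * Re (phi_quad A p)"
      using s c(2)[of p] mult_right_mono[of m c "(norm p)\<^sup>2"] by (intro mult_left_mono) (auto simp: m_def)
    ultimately show ?thesis by (simp add: algebra_simps)
  qed
  have P: "positive_hermitian_part (P s)" if s: "s \<in> {0..1}" for s
    unfolding positive_hermitian_part_iff
  proof (intro allI impI)
    fix p :: "(real, 'n) vec \<times> (real, 'n) vec"
    assume "p \<noteq> 0"
    then have "0 < m * (norm p)\<^sup>2" using m by simp
    then show "0 < Re (phi_quad (P s) p)" using coercive[OF s, of p] by linarith
  qed
  define Z where "Z = (\<lambda>s. \<integral>p. exp (- phi_quad (P s) p) \<partial>lborel)"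
  define D where "D = (\<lambda>s. form_coeff (fermi_exp (P s)) 0 UNIV)"
  define Z' where "Z' = (\<lambda>s. \<integral>p. exp (- phi_quad (P s) p) * (- phi_quad B p) \<partial>lborel)"
  define D' where "D' = (\<lambda>s. - form_coeff (psi_quad B * fermi_exp (P s)) 0 UNIV)"
  have B_poly: "cpoly (\<lambda>p. - phi_quad B p)"
    by (intro cpoly_uminus cpoly_phi_quad)
  note int = integrable_exp_mult_cpoly[OF cpoly_phi_quad m coercive]
  have DZ: "super_expectation (P s) 1 = D s * Z s" for s
    by (simp add: super_expectation_one_factor Z_def D_def)
  have dD: "(D has_vector_derivative D' s) (at s within {0..1})" for s
    unfolding D_def D'_def form_coeff_uminus[symmetric]
    by (rule has_form_derivativeD[OF has_form_derivative_fermi_exp[of P, OF psi_P]])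
  have dZ: "(Z has_vector_derivative Z' t) (at t within {0..1})" if t: "t \<in> {0..1}" for t
  proof -
    obtain K where K: "K \<ge> 0" "\<And>p. exp (- m * (norm p)\<^sup>2) * norm (- phi_quad B p) \<le> K * exp (- (m / 2) * (norm p)\<^sup>2)"
      using gaussian_cpoly_bound[OF B_poly m] by blast
    show ?thesis
      unfolding Z_def Z'_def
    proof (rule has_vector_derivative_integral[where G = "\<lambda>p. K * exp (- (m / 2) * (norm p)\<^sup>2)"])
      show "((\<lambda>s. exp (- phi_quad (P s) p)) has_vector_derivative exp (- phi_quad (P s) p) * - phi_quad B p) (at s within {0..1})" for s p
      proof -
        have "((\<lambda>s. - phi_quad (P s) p) has_vector_derivative - phi_quad B p) (at s within {0..1})"
          unfolding phi_P by (auto intro!: derivative_eq_intros)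
        from field_vector_diff_chain_within[OF this has_field_derivative_at_within[OF DERIV_exp]]
        show ?thesis by (simp add: o_def mult.commute)
      qed
      show "integrable lborel (\<lambda>p. exp (- phi_quad (P s) p))" if "s \<in> {0..1}" for s
        using int[OF that cpoly_const[of 1]] by simp
      show "(\<lambda>p. exp (- phi_quad (P s) p) * - phi_quad B p) \<in> borel_measurable lborel" if "s \<in> {0..1}" for s
        using int[OF that B_poly] by (rule borel_measurable_integrable)
      show "norm (exp (- phi_quad (P s) p) * - phi_quad B p) \<le> K * exp (- (m / 2) * (norm p)\<^sup>2)" if "s \<in> {0..1}" for s p
      proof -
        have "norm (exp (- phi_quad (P s) p)) * norm (- phi_quad B p) \<le> exp (- m * (norm p)\<^sup>2) * norm (- phi_quad B p)"
          using coercive[OF that, of p] by (intro mult_right_mono) auto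
        then show ?thesis using K(2)[of p] by (simp only: norm_mult)
      qed
      show "integrable lborel (\<lambda>p :: (real, 'n) vec \<times> (real, 'n) vec. K * exp (- (m / 2) * (norm p)\<^sup>2))"
        using has_bochner_integral_gaussian[of "m / 2", where 'a = "(real, 'n) vec \<times> (real, 'n) vec"] m
        by (intro integrable_mult_right) (auto simp: has_bochner_integral_iff)
    qed (rule t)
  qed
  have zero: "D s * Z' s + D' s * Z s = 0" if s: "s \<in> {0..1}" for s
  proof -
    have T: "super_expectation (P s) (fun_form (\<lambda>p. phi x p * phi_bar y p) + psi x * psi_bar y) = 0" for x y
    proof -
      have eq: "fun_form (\<lambda>p. phi x p * phi_bar y p) + psi x * psi_bar y =
          fun_form (phi_bar y) * (fun_form (phi x) * tau_prod {}) - psi_bar y * (psi x * tau_prod {})"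
        by (simp add: psi_psi_bar_anticommute fun_form_mult fun_form_commute[of "fun_form (phi_bar y)"])
      show ?thesis
        unfolding eq using boson_fermion_cancel[OF P[OF s], of x "{}" y]
        by (subst super_expectation_diff[OF P[OF s]])
           (auto intro!: poly_form_intros poly_form_tau_prod cpoly_phi simp del: tau_prod_empty)
    qed
    have "fun_form (phi_quad B) + psi_quad B =
        (\<Sum>x\<in>UNIV. \<Sum>y\<in>UNIV. const_form (B $ x $ y) * (fun_form (\<lambda>p. phi x p * phi_bar y p) + psi x * psi_bar y))"
      by (rule form_eqI)
         (auto simp: form_coeff_fun_form phi_quad_def psi_quad_def mult.assoc sum.distrib distrib_left mult.left_commute mult.commute[of "phi_bar _ _"])
    then have "super_expectation (P s) (fun_form (phi_quad B) + psi_quad B) = 0"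
      by (simp add: super_expectation_sum[OF P[OF s]] super_expectation_const_mult T poly_form_intros cpoly_mult cpoly_const)
    moreover have "super_expectation (P s) (fun_form (phi_quad B) + psi_quad B) =
        (\<integral>p. exp (- phi_quad (P s) p) * (phi_quad B p * D s + - D' s) \<partial>lborel)"
    proof -
      have "form_coeff (fermi_exp (P s) * (fun_form (phi_quad B) + psi_quad B)) p UNIV = phi_quad B p * D s + - D' s" for p
      proof -
        have "form_coeff (fermi_exp (P s)) p UNIV = D s"
          unfolding D_def by (rule constant_formD[OF constant_form_fermi_exp])
        moreover have "form_coeff (psi_quad B * fermi_exp (P s)) p UNIV = - D' s"
          unfolding D'_def minus_minus
          by (rule constant_formD[OF constant_form_mult[OF constant_form_psi_quad constant_form_fermi_exp]])
        ultimately show ?thesis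
          by (simp add: distrib_left even_form_commute[of "fermi_exp (P s)" "psi_quad B"])
      qed
      then show ?thesis
        unfolding super_expectation_def form_integral_def form_coeff_exp_neg_S_mult by simp
    qed
    moreover have "(\<integral>p. exp (- phi_quad (P s) p) * (phi_quad B p * D s + - D' s) \<partial>lborel) =
       (\<integral>p. - D s * (exp (- phi_quad (P s) p) * - phi_quad B p) + - D' s * exp (- phi_quad (P s) p) \<partial>lborel)"
      by (intro Bochner_Integration.integral_cong refl) (simp add: algebra_simps)
    moreover have "\<dots> = - D s * Z' s + - D' s * Z s"
    proof -
      have "integrable lborel (\<lambda>p. exp (- phi_quad (P s) p) * - phi_quad B p)"
        "integrable lborel (\<lambda>p. exp (- phi_quad (P s) p))"
        using int[OF s B_poly] int[OF s cpoly_const[of 1]] by simp_all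
      then show ?thesis
        unfolding Z_def Z'_def by (subst Bochner_Integration.integral_add) (intro integrable_mult_right | simp)+
    qed
    ultimately have "- (D s * Z' s + D' s * Z s) = 0"
      by simp
    then show ?thesis by (simp only: neg_equal_0_iff_equal)
  qed
  have "((\<lambda>s. D s * Z s) has_vector_derivative 0) (at s within {0..1})" if s: "s \<in> {0..1}" for s
    using has_vector_derivative_mult[OF dD dZ[OF s]] unfolding zero[OF s] .
  then obtain k where k: "\<And>s. s \<in> {0..1} \<Longrightarrow> D s * Z s = k"
    using has_vector_derivative_zero_constant[of "{0..1::real}" "\<lambda>s. D s * Z s"] by (auto simp: convex_real_interval)
  have "super_expectation A 1 = D 1 * Z 1"
    using DZ[of 1] by (simp add: P_def B_def)
  also have "\<dots> = D 0 * Z 0" using k[of 0] k[of 1] by simp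
  also have "\<dots> = super_expectation (mat 1 :: complex^'n::{finite,linorder}^'n::{finite,linorder}) 1"
    using DZ[of 0] by (simp add: P_def)
  finally show ?thesis by (simp add: super_expectation_one_mat_one)
qed

section \<open>The self-avoiding walk recursion\<close>

text \<open>
  If \<open>X\<close> contains neither \<open>a\<close> nor \<open>b\<close>, this is the sum over the self-avoiding walks from \<open>a\<close> to \<open>b\<close> with inner points in
  \<open>X\<close>. The recursion closes in this quantity: after a step to \<open>x\<close> the walk starts at \<open>x\<close>, and \<open>x\<close> is removed from \<open>X\<close>.
\<close>

definition walk_sum :: "complex^'n^'n \<Rightarrow> 'n \<Rightarrow> 'n \<Rightarrow> 'n set \<Rightarrow> complex" where
  "walk_sum C a b X = (\<Sum>xs | distinct xs \<and> set xs \<subseteq> X. walk_weight C (a # xs @ [b]))"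

lemma walk_weight_Cons_Cons: "walk_weight C (a # x # xs) = C $ a $ x * walk_weight C (x # xs)"
proof -
  have "walk_weight C (a # x # xs) = (\<Prod>i = 1..Suc (length xs). C $ ((a # x # xs) ! (i - 1)) $ ((a # x # xs) ! i))"
    by (simp add: walk_weight_def)
  also have "\<dots> = C $ a $ x * (\<Prod>i = Suc 1..Suc (length xs). C $ ((a # x # xs) ! (i - 1)) $ ((a # x # xs) ! i))"
    by (subst prod.atLeast_Suc_atMost) auto
  also have "(\<Prod>i = Suc 1..Suc (length xs). C $ ((a # x # xs) ! (i - 1)) $ ((a # x # xs) ! i)) =
      (\<Prod>i = 1..length xs. C $ ((x # xs) ! (i - 1)) $ ((x # xs) ! i))"
    unfolding prod.shift_bounds_cl_Suc_ivl by (rule prod.cong) (auto simp: nth_Cons')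
  finally show ?thesis by (simp add: walk_weight_def)
qed

lemma finite_distinct_lists: "finite {xs. distinct xs \<and> set xs \<subseteq> (X :: 'n::finite set)}"
  using finite_subset_distinct[of X] by (simp add: conj_commute)

lemma walk_sum_step:
  fixes C :: "complex^'n::finite^'n"
  shows "walk_sum C a b X = C $ a $ b + (\<Sum>x\<in>X. C $ a $ x * walk_sum C x b (X - {x}))"
proof -
  let ?L = "\<lambda>X :: 'n set. {xs. distinct xs \<and> set xs \<subseteq> X}"
  have L: "?L X = insert [] (\<Union>x\<in>X. (#) x ` ?L (X - {x}))"
  proof (intro set_eqI)
    fix xs
    show "xs \<in> ?L X \<longleftrightarrow> xs \<in> insert [] (\<Union>x\<in>X. (#) x ` ?L (X - {x}))"
      by (cases xs) auto
  qed
  have "walk_sum C a b X = walk_weight C [a, b] + (\<Sum>xs\<in>(\<Union>x\<in>X. (#) x ` ?L (X - {x})). walk_weight C (a # xs @ [b]))"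
    unfolding walk_sum_def by (subst L, subst sum.insert) (auto intro!: finite_imageI finite_distinct_lists)
  also have "(\<Sum>xs\<in>(\<Union>x\<in>X. (#) x ` ?L (X - {x})). walk_weight C (a # xs @ [b])) =
      (\<Sum>x\<in>X. \<Sum>xs\<in>(#) x ` ?L (X - {x}). walk_weight C (a # xs @ [b]))"
    by (rule sum.UNION_disjoint) (auto intro!: finite_imageI finite_distinct_lists)
  also have "\<dots> = (\<Sum>x\<in>X. C $ a $ x * walk_sum C x b (X - {x}))"
    by (intro sum.cong refl, subst sum.reindex)
       (auto simp: walk_weight_Cons_Cons walk_sum_def sum_distrib_left)
  also have "walk_weight C [a, b] = C $ a $ b"
    by (simp add: walk_weight_def)
  finally show ?thesis .
qed

lemma saw_two_point_eq_walk_sum: "saw_two_point C a b = walk_sum C a b (UNIV - {a, b})"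
proof -
  have "self_avoiding_walks a b = (\<lambda>xs. a # xs @ [b]) ` {xs. distinct xs \<and> set xs \<subseteq> UNIV - {a, b}}"
    unfolding self_avoiding_walks_def by auto
  then show ?thesis
    unfolding saw_two_point_def walk_sum_def by (simp add: sum.reindex inj_on_def)
qed

lemma super_expectation_eq_walk_sum:
  assumes A: "positive_hermitian_part A" and b: "b \<notin> X"
  shows "super_expectation A (fun_form (phi_bar a) * (fun_form (phi b) * tau_prod X)) = walk_sum (matrix_inv A) a b X"
  using finite[of X] b
proof (induction X arbitrary: a rule: finite_psubset_induct)
  case (psubset X)
  have "super_expectation A (fun_form (phi_bar x) * (fun_form (phi b) * tau_prod (X - {x}))) =
      walk_sum (matrix_inv A) x b (X - {x})" if "x \<in> X" for x
    using that psubset.prems by (intro psubset.IH) auto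
  then show ?case
    unfolding super_expectation_phi_bar_phi[OF A psubset.prems] walk_sum_step[of _ a]
    by (simp add: super_expectation_tau_prod[OF A] super_expectation_one[OF A])
qed

theorem theorem5p2:
  fixes A :: "complex^'n::{finite,linorder}^'n::{finite,linorder}" and a b :: 'n
  assumes "positive_hermitian_part A"
  shows "let \<omega> = exp_neg_S A * fun_form (\<lambda>p. phi_bar a p * phi b p) * ordered_prod (\<lambda>x. 1 + tau x) (UNIV - {a, b})
         in form_integrable \<omega> \<and> saw_two_point (matrix_inv A) a b = form_integral \<omega>"
proof -
  define F where "F = fun_form (phi_bar a) * (fun_form (phi b) * tau_prod (UNIV - {a, b}))"
  have \<omega>: "exp_neg_S A * fun_form (\<lambda>p. phi_bar a p * phi b p) * tau_prod (UNIV - {a, b}) = exp_neg_S A * F"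
    by (simp add: F_def fun_form_mult mult.assoc)
  have "poly_form F"
    unfolding F_def by (intro poly_form_intros poly_form_tau_prod cpoly_phi)
  then have "form_integrable (exp_neg_S A * F)"
    by (rule form_integrable_exp_neg_S_mult[OF assms])
  moreover have "saw_two_point (matrix_inv A) a b = form_integral (exp_neg_S A * F)"
    using super_expectation_eq_walk_sum[OF assms, of b "UNIV - {a, b}" a]
    by (simp add: saw_two_point_eq_walk_sum F_def super_expectation_def)
  ultimately show ?thesis
    unfolding Let_def \<omega> by blast
qed

end
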